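(* Let $d\ge2$, let $p\in(0,1)$, and let $\{\eta_t\}_{t\ge0}$ be the symmetric simple exclusion process (SSEP) on the regular tree $\mathcal{T}_d$. For any local function $F:\{0,1\}^{\mathcal{T}_d}\to\mathbb{R}$ with $\int F\,d\nu_p=0$, there exists $\sigma_F^2<+\infty$ such that $$\lim_{t\to+\infty}\frac1t\mathrm{Var}_{\nu_p}\left(\xi_t^F\right)=\sigma_F^2,$$ where $\xi_t^F=\int_0^tF(\eta_s)\,ds$.
   Context: $\mathcal{T}_d$ is the (infinite) regular tree in which each vertex has $d+1$ neighbors; $x\sim y$ means that $x,y$ are neighbors. A function on $\{0,1\}^{\mathcal{T}_d}$ is local if it depends on finitely many coordinates. The SSEP $\{\eta_t\}_{t\ge0}$ on $\mathcal{T}_d$ is the continuous-time Markov process with state space $\{0,1\}^{\mathcal{T}_d}$ and generator $$\mathcal{L}f(\eta)=\frac12\sum_{x\in\mathcal{T}_d}\sum_{y\sim x}\left(f(\eta^{x,y})-f(\eta)\right)$$ for local $f:\{0,1\}^{\mathcal{T}_d}\to\mathbb{R}$, where $\eta^{x,y}$ is obtained from $\eta$ by exchanging the values at $x$ and $y$ (so the values at the two ends of each edge are exchanged at rate $1$). $\nu_p$ is the product measure on $\{0,1\}^{\mathcal{T}_d}$ with $\nu_p(\eta(x)=1)=p$ for every $x$; it is reversible for the SSEP. $\mathrm{Var}_{\nu_p}$ is the variance under the law of the SSEP started from $\nu_p$. *)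

theory Defs
  imports "HOL-Probability.Probability" "HOL-Combinatorics.Transposition"
begin

section \<open>Regular trees\<close>

text \<open>A simple graph whose vertex set is the whole type is given by its adjacency relation.\<close>

definition simple_graph :: "('v \<Rightarrow> 'v \<Rightarrow> bool) \<Rightarrow> bool" where
  "simple_graph adj \<longleftrightarrow> symp adj \<and> irreflp adj"

definition graph_cycle :: "('v \<Rightarrow> 'v \<Rightarrow> bool) \<Rightarrow> 'v list \<Rightarrow> bool" where
  "graph_cycle adj xs \<longleftrightarrow>
     length xs \<ge> 3 \<and> distinct xs \<and> successively adj xs \<and> adj (last xs) (hd xs)"

definition graph_tree :: "('v \<Rightarrow> 'v \<Rightarrow> bool) \<Rightarrow> bool" where
  "graph_tree adj \<longleftrightarrow>
     simple_graph adj \<and> (\<forall>x y. adj\<^sup>*\<^sup>* x y) \<and> (\<nexists>xs. graph_cycle adj xs)"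

text \<open>For \<open>d \<ge> 1\<close> these axioms force the tree to be infinite, and determine it up to isomorphism.\<close>

definition regular_tree :: "nat \<Rightarrow> ('v \<Rightarrow> 'v \<Rightarrow> bool) \<Rightarrow> bool" where
  "regular_tree d adj \<longleftrightarrow> graph_tree adj \<and> (\<forall>x. card {y. adj x y} = d + 1)"


section \<open>Configurations\<close>

text \<open>Configurations are maps to \<^typ>\<open>bool\<close> (\<^const>\<open>True\<close> for occupied, i.e. the value 1), with the
  product topology of the discrete topology on \<^typ>\<open>bool\<close> and the product sigma-algebra.\<close>

type_synonym 'v config = "'v \<Rightarrow> bool"

definition config_space :: "'v config measure" where
  "config_space = (\<Pi>\<^sub>M x\<in>UNIV. count_space UNIV)"

definition bernoulli_product :: "real \<Rightarrow> 'v config measure" where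
  "bernoulli_product p = (\<Pi>\<^sub>M x\<in>UNIV. measure_pmf (bernoulli_pmf p))"

definition local_fun :: "('v config \<Rightarrow> real) \<Rightarrow> bool" where
  "local_fun f \<longleftrightarrow>
     (\<exists>A. finite A \<and> (\<forall>\<eta> \<zeta>. (\<forall>x\<in>A. \<eta> x = \<zeta> x) \<longrightarrow> f \<eta> = f \<zeta>))"

definition exchange :: "'v \<Rightarrow> 'v \<Rightarrow> 'v config \<Rightarrow> 'v config" where
  "exchange x y \<eta> = \<eta> \<circ> Transposition.transpose x y"

text \<open>On a locally finite graph and for local \<open>f\<close>, only finitely many terms of the outer sum are
  nonzero.\<close>

definition ssep_generator ::
    "('v \<Rightarrow> 'v \<Rightarrow> bool) \<Rightarrow> ('v config \<Rightarrow> real) \<Rightarrow> 'v config \<Rightarrow> real" where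
  "ssep_generator adj f \<eta> =
     1/2 * (\<Sum>\<^sub>\<infinity>x. \<Sum>y | adj x y. f (exchange x y \<eta>) - f \<eta>)"


section \<open>Markov semigroups and processes\<close>

text \<open>Strongly continuous Markov semigroups on the continuous functions; the bounded continuous
  functions on \<^typ>\<open>'v config\<close> are all continuous functions, as this space is compact.\<close>

definition markov_semigroup ::
    "(real \<Rightarrow> ('a::topological_space \<Rightarrow>\<^sub>C real) \<Rightarrow> ('a \<Rightarrow>\<^sub>C real)) \<Rightarrow> bool" where
  "markov_semigroup S \<longleftrightarrow>
     (\<forall>t\<ge>0. linear (S t)) \<and>
     (\<forall>f. S 0 f = f) \<and>
     (\<forall>s\<ge>0. \<forall>t\<ge>0. \<forall>f. S (s + t) f = S s (S t f)) \<and>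
     (\<forall>t\<ge>0. S t (const_bcontfun 1) = const_bcontfun 1) \<and>
     (\<forall>t\<ge>0. \<forall>f. (\<forall>x. apply_bcontfun f x \<ge> 0) \<longrightarrow> (\<forall>x. apply_bcontfun (S t f) x \<ge> 0)) \<and>
     (\<forall>f. ((\<lambda>t. S t f) \<longlongrightarrow> f) (at_right 0))"

text \<open>\<open>has_generator_value S f g\<close>: \<open>f\<close> is in the domain of the infinitesimal generator of \<open>S\<close>,
  which maps it to \<open>g\<close>.\<close>

definition has_generator_value ::
    "(real \<Rightarrow> ('a::topological_space \<Rightarrow>\<^sub>C real) \<Rightarrow> ('a \<Rightarrow>\<^sub>C real))
      \<Rightarrow> ('a \<Rightarrow>\<^sub>C real) \<Rightarrow> ('a \<Rightarrow>\<^sub>C real) \<Rightarrow> bool" where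
  "has_generator_value S f g \<longleftrightarrow> ((\<lambda>t. (S t f - f) /\<^sub>R t) \<longlongrightarrow> g) (at_right 0)"

text \<open>The generator of the semigroup is given on local functions by \<^const>\<open>ssep_generator\<close>. On a
  graph of bounded degree this determines the semigroup, since the local functions are a core.\<close>

definition ssep_semigroup ::
    "('v \<Rightarrow> 'v \<Rightarrow> bool) \<Rightarrow> (real \<Rightarrow> ('v config \<Rightarrow>\<^sub>C real) \<Rightarrow> ('v config \<Rightarrow>\<^sub>C real)) \<Rightarrow> bool" where
  "ssep_semigroup adj S \<longleftrightarrow>
     markov_semigroup S \<and>
     (\<forall>f. local_fun f \<longrightarrow>
        (\<exists>g h. apply_bcontfun g = f \<and> apply_bcontfun h = ssep_generator adj f \<and>
               has_generator_value S g h))"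

definition cadlag :: "(real \<Rightarrow> 'a::topological_space) \<Rightarrow> bool" where
  "cadlag \<gamma> \<longleftrightarrow>
     (\<forall>t\<ge>0. (\<gamma> \<longlongrightarrow> \<gamma> t) (at_right t)) \<and> (\<forall>t>0. \<exists>l. (\<gamma> \<longlongrightarrow> l) (at_left t))"

text \<open>The sigma-algebra generated by \<open>X u\<close>, \<open>0 \<le> u \<le> s\<close>.\<close>

definition natural_filtration ::
    "'w measure \<Rightarrow> 'a measure \<Rightarrow> (real \<Rightarrow> 'w \<Rightarrow> 'a) \<Rightarrow> real \<Rightarrow> 'w measure" where
  "natural_filtration M N X s =
     vimage_algebra (space M) (\<lambda>\<omega>. \<lambda>u\<in>{0..s}. X u \<omega>) (\<Pi>\<^sub>M u\<in>{0..s}. N)"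

text \<open>The time set is \<open>[0, \<infinity>)\<close>: the values of \<open>X\<close> at negative times are irrelevant.\<close>

definition markov_process ::
    "'w measure \<Rightarrow> 'a measure \<Rightarrow> (real \<Rightarrow> 'w \<Rightarrow> 'a::topological_space)
      \<Rightarrow> (real \<Rightarrow> ('a \<Rightarrow>\<^sub>C real) \<Rightarrow> ('a \<Rightarrow>\<^sub>C real)) \<Rightarrow> bool" where
  "markov_process M N X S \<longleftrightarrow>
     prob_space M \<and>
     (\<forall>t\<ge>0. X t \<in> M \<rightarrow>\<^sub>M N) \<and>
     (\<forall>\<omega>\<in>space M. cadlag (\<lambda>t. X t \<omega>)) \<and>
     (\<forall>s\<ge>0. \<forall>t\<ge>0. \<forall>f. AE \<omega> in M.
        real_cond_exp M (natural_filtration M N X s) (\<lambda>\<omega>. apply_bcontfun f (X (s + t) \<omega>)) \<omega>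
          = apply_bcontfun (S t f) (X s \<omega>))"

definition ssep :: "('v \<Rightarrow> 'v \<Rightarrow> bool) \<Rightarrow> 'w measure \<Rightarrow> (real \<Rightarrow> 'w \<Rightarrow> 'v config) \<Rightarrow> bool" where
  "ssep adj M \<eta> \<longleftrightarrow> (\<exists>S. ssep_semigroup adj S \<and> markov_process M config_space \<eta> S)"

definition additive_functional ::
    "(real \<Rightarrow> 'w \<Rightarrow> 'v config) \<Rightarrow> ('v config \<Rightarrow> real) \<Rightarrow> real \<Rightarrow> 'w \<Rightarrow> real" where
  "additive_functional \<eta> F t \<omega> = (LINT s:{0..t}|lborel. F (\<eta> s \<omega>))"

end

theory Submission
  imports Defs
begin

text \<open>The variance of a time integral of a centred stationary process is a double integral of its
  autocovariance \<open>C\<close>, so after division by \<open>t\<close> it converges to \<open>\<integral> C \<bar>u\<bar> du\<close> if \<open>C\<close> decays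
  exponentially (\<open>variance_additive_functional_tendsto\<close>). The limit is a square because variances are
  nonnegative. It remains to see that the autocovariance of a local function does decay in this way.

  The products \<open>\<Prod>x\<in>A. (\<eta> x - p)\<close> over finite sets \<open>A\<close> are orthogonal under the Bernoulli measure,
  and every local function is a finite linear combination of them; the mean of the function is the
  coefficient of the empty product. Exchanging the values at \<open>x\<close> and \<open>y\<close> turns the product over \<open>A\<close>
  into the product over the image of \<open>A\<close> under the transposition of \<open>x\<close> and \<open>y\<close>. The generator of
  the exclusion process therefore acts on the index sets as the generator of \<open>card A\<close> exclusion
  particles (\<open>ssep_generator_centered_product\<close>). This is the self-duality of the process: up to a
  factor \<open>(p (1 - p)) ^ card B\<close>, the covariance of the product over \<open>B\<close> at time \<open>0\<close> with the product
  over \<open>A\<close> at time \<open>t\<close> is the probability that the particles started from \<open>A\<close> occupy \<open>B\<close> at time \<open>t\<close>.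

  These probabilities are small because the tree is nonamenable. The weight
  \<open>w x = d powr (- level x / 2)\<close>, with levels counted from a root, satisfies
  \<open>(\<Sum>y\<sim>x. w y) \<le> 2 * sqrt d * w x\<close>, and \<open>2 * sqrt d\<close> is smaller than the degree \<open>d + 1\<close> by
  \<open>\<kappa> = (sqrt d - 1)\<^sup>2\<close>. The product of \<open>w\<close> over the occupied set inherits this property under the
  exclusion dynamics: in comparison with independent particles, only the jumps between occupied
  neighbours are lost, and their total contribution is nonnegative since \<open>w y / w x + w x / w y \<ge> 2\<close>
  (\<open>stirring_mean_prod_le\<close>). Hence the probability of moving from \<open>A\<close> to \<open>B\<close> in time \<open>t\<close> is at most
  \<open>prod w A / prod w B * exp (- \<kappa> * t)\<close>.

  The semigroup is known only through its generator on local functions. The particle system is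
  therefore introduced in discrete time, by the operator \<open>stirring_mean\<close> that averages over all jumps, and
  the semigroup is recovered from its iterates by uniformization: \<open>S t\<close> applied to the product over
  \<open>A\<close> is the average of the iterates with Poisson weights of parameter \<open>\<Lambda> * t\<close>
  (\<open>markov_semigroup_uniformization\<close>). This series also shows that the Bernoulli measure is
  invariant.\<close>

section \<open>A strictly superharmonic weight on the regular tree\<close>

text \<open>Cutting out loops turns a walk into a path. That all vertices of the path are reachable under
  the same relation lets a restricted relation certify which vertices the path avoids.\<close>

lemma rtranclp_distinct_path:
  assumes "R\<^sup>*\<^sup>* x y"
  obtains xs where "xs \<noteq> []" "hd xs = x" "last xs = y" "distinct xs" "successively R xs"
    "\<And>u. u \<in> set xs \<Longrightarrow> R\<^sup>*\<^sup>* x u"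
proof -
  have "\<exists>xs. xs \<noteq> [] \<and> hd xs = x \<and> last xs = y \<and> distinct xs \<and> successively R xs
      \<and> (\<forall>u\<in>set xs. R\<^sup>*\<^sup>* x u)"
    using assms
  proof (induction rule: converse_rtranclp_induct)
    case base
    then show ?case by (intro exI[of _ "[y]"]) auto
  next
    case (step x z)
    then obtain xs where xs: "xs \<noteq> []" "hd xs = z" "last xs = y" "distinct xs" "successively R xs"
      "\<forall>u\<in>set xs. R\<^sup>*\<^sup>* z u" by blast
    have reach: "\<forall>u\<in>set xs. R\<^sup>*\<^sup>* x u"
      using xs(6) step(1) by (meson converse_rtranclp_into_rtranclp)
    show ?case
    proof (cases "x \<in> set xs")
      case True
      then obtain us vs where xs_eq: "xs = us @ x # vs" by (meson split_list)
      show ?thesis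
        by (rule exI[of _ "x # vs"])
          (use xs reach in \<open>auto simp: xs_eq successively_append_iff\<close>)
    next
      case False
      then show ?thesis
        by (intro exI[of _ "x # xs"])
          (use xs reach step(1) in \<open>auto simp: successively_Cons\<close>)
    qed
  qed
  then show thesis using that by blast
qed

text \<open>A path between two neighbours of \<open>x\<close> that avoids \<open>x\<close> closes up to a cycle through \<open>x\<close>.\<close>

lemma tree_neighbours_separated:
  assumes tree: "graph_tree adj" and xy: "adj x y" and xz: "adj x z"
    and conn: "(\<lambda>u v. adj u v \<and> u \<noteq> x \<and> v \<noteq> x)\<^sup>*\<^sup>* y z"
  shows "y = z"
proof (rule ccontr)
  assume "y \<noteq> z"
  let ?R = "\<lambda>u v. adj u v \<and> u \<noteq> x \<and> v \<noteq> x"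
  have sym: "symp adj" and irr: "irreflp adj"
    using tree by (auto simp: graph_tree_def simple_graph_def)
  obtain xs where xs: "xs \<noteq> []" "hd xs = y" "last xs = z" "distinct xs" "successively ?R xs"
    and reach: "\<And>u. u \<in> set xs \<Longrightarrow> ?R\<^sup>*\<^sup>* y u"
    using rtranclp_distinct_path[OF conn] by blast
  have "y \<noteq> x" using xy irr by (auto simp: irreflp_def)
  then have "x \<notin> set xs" using reach by (auto elim: rtranclp.cases)
  moreover have "successively adj xs"
    by (rule successively_mono[OF xs(5)]) auto
  moreover have "length xs \<ge> 2"
  proof (rule ccontr)
    assume "\<not> length xs \<ge> 2"
    then obtain a where "xs = [a]" using xs(1) by (cases xs; cases "tl xs") auto
    then show False using xs \<open>y \<noteq> z\<close> by simp
  qed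
  ultimately have "graph_cycle adj (x # xs)"
    using xs xy xz sym by (auto simp: graph_cycle_def successively_Cons dest: sympD)
  then show False using tree by (auto simp: graph_tree_def)
qed

definition graph_level :: "('v \<Rightarrow> 'v \<Rightarrow> bool) \<Rightarrow> 'v \<Rightarrow> 'v \<Rightarrow> nat" where
  "graph_level adj r x = (LEAST n. (adj ^^ n) r x)"

lemma
  assumes conn: "\<And>x. adj\<^sup>*\<^sup>* r x" and sym: "symp adj"
  shows graph_level_eq_0: "graph_level adj r x = 0 \<Longrightarrow> x = r"
    and graph_level_adj_le: "adj x y \<Longrightarrow> graph_level adj r y \<le> Suc (graph_level adj r x)"
    and graph_level_descend:
      "graph_level adj r x = Suc n \<Longrightarrow> \<exists>y. adj x y \<and> graph_level adj r y = n"
proof -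
  have path: "(adj ^^ graph_level adj r x) r x" for x
    unfolding graph_level_def by (rule LeastI_ex) (use conn[of x] in \<open>auto simp: rtranclp_power\<close>)
  have least: "graph_level adj r x \<le> n" if "(adj ^^ n) r x" for n x
    unfolding graph_level_def using that by (rule Least_le)
  have up: "graph_level adj r y \<le> Suc (graph_level adj r x)" if "adj x y" for x y
    using path[of x] that by (intro least) (auto intro: relpowp_Suc_I)
  show "x = r" if "graph_level adj r x = 0"
    using path[of x] that by simp
  show "graph_level adj r y \<le> Suc (graph_level adj r x)" if "adj x y"
    by (rule up[OF that])
  show "\<exists>y. adj x y \<and> graph_level adj r y = n" if n: "graph_level adj r x = Suc n"
  proof -
    obtain y where y: "(adj ^^ n) r y" "adj y x" using path[of x] n by (auto elim: relpowp_Suc_E)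
    then have "graph_level adj r y \<le> n" using least by blast
    moreover have "Suc n \<le> Suc (graph_level adj r y)" using up[OF y(2)] n by simp
    ultimately show ?thesis using y(2) sym by (auto dest: sympD)
  qed
qed

text \<open>Descending towards the root from a neighbour of \<open>x\<close> that is not above \<open>x\<close> never meets \<open>x\<close>, so two
  such neighbours would be connected through the root in the complement of \<open>x\<close>.\<close>

lemma tree_unique_lower_neighbour:
  assumes tree: "graph_tree adj" and xy: "adj x y" and xz: "adj x z"
    and ly: "graph_level adj r y \<le> graph_level adj r x"
    and lz: "graph_level adj r z \<le> graph_level adj r x"
  shows "y = z"
proof -
  let ?R = "\<lambda>u v. adj u v \<and> u \<noteq> x \<and> v \<noteq> x"
  have sym: "symp adj" and irr: "irreflp adj" and conn: "\<And>u. adj\<^sup>*\<^sup>* r u"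
    using tree by (auto simp: graph_tree_def simple_graph_def)
  have descend: "?R\<^sup>*\<^sup>* u r" if "u \<noteq> x" "graph_level adj r u \<le> graph_level adj r x" for u
    using that
  proof (induction "graph_level adj r u" arbitrary: u)
    case 0
    then show ?case using graph_level_eq_0[OF conn sym, of u] by simp
  next
    case (Suc n)
    obtain v where v: "adj u v" "graph_level adj r v = n"
      using graph_level_descend[OF conn sym, of u n] Suc.hyps(2) by auto
    then have "v \<noteq> x" using Suc by auto
    then have "?R\<^sup>*\<^sup>* v r" using Suc.hyps(1)[of v] v Suc.prems Suc.hyps(2) by auto
    then show ?case using v(1) \<open>v \<noteq> x\<close> Suc.prems(1)
      by (intro converse_rtranclp_into_rtranclp[of ?R u v]) auto
  qed
  have "symp ?R" using sym by (auto simp: symp_def)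
  then have symR: "symp ?R\<^sup>*\<^sup>*" by (rule symp_rtranclp)
  have "y \<noteq> x" "z \<noteq> x" using xy xz irr by (auto simp: irreflp_def)
  then have "?R\<^sup>*\<^sup>* y r" "?R\<^sup>*\<^sup>* r z"
    using descend ly lz symR by (auto dest: sympD)
  then have "?R\<^sup>*\<^sup>* y z" by (rule rtranclp_trans)
  then show ?thesis by (rule tree_neighbours_separated[OF tree xy xz])
qed

text \<open>The weight decreases by the factor \<open>1 / sqrt d\<close> per level. A vertex with a parent and \<open>d\<close>
  children then sees the neighbour sum \<open>(sqrt d + d / sqrt d) * w x\<close>; this ratio \<open>1 / sqrt d\<close> is
  the one that makes the sum smallest, and it gives the bottom of the spectrum of the Laplacian of the tree,
  \<open>\<kappa> = (sqrt d - 1)\<^sup>2\<close>.\<close>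

lemma regular_tree_superharmonic:
  assumes d: "d \<ge> 2" and tree: "regular_tree d adj"
  obtains w :: "'v \<Rightarrow> real" and \<kappa> :: real where
    "\<kappa> > 0" "\<And>x. w x > 0" "\<And>x. (\<Sum>y | adj x y. w y) \<le> (real d + 1 - \<kappa>) * w x"
proof -
  fix r :: 'v
  define l where "l = graph_level adj r"
  define a where "a = 1 / sqrt (real d)"
  define w where "w x = a ^ l x" for x
  have gt: "graph_tree adj" and deg: "\<And>x. card {y. adj x y} = d + 1"
    using tree by (auto simp: regular_tree_def)
  have fin: "finite {y. adj x y}" for x using deg[of x] by (metis card.infinite add_is_0 one_neq_zero)
  have sym: "symp adj" and conn: "\<And>u. adj\<^sup>*\<^sup>* r u"
    using gt by (auto simp: graph_tree_def simple_graph_def)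
  have a: "0 < a" "a \<le> 1" using d by (auto simp: a_def)
  have da: "real d * a = sqrt (real d)" "1 / a = sqrt (real d)"
    using d by (auto simp: a_def field_simps simp flip: power2_eq_square)
  have wpos: "w x > 0" for x using a by (simp add: w_def)
  have upper: "w y = a * w x" if "adj x y" "\<not> l y \<le> l x" for x y
    using that graph_level_adj_le[OF conn sym that(1)] by (auto simp: w_def l_def le_Suc_eq)
  have "(\<Sum>y | adj x y. w y) \<le> 2 * sqrt d * w x" for x
  proof (cases "\<exists>z. adj x z \<and> l z \<le> l x")
    case True
    then obtain z where z: "adj x z" "l z \<le> l x" by blast
    have zw: "w z \<le> w x * (1 / a)"
    proof -
      have "l x \<le> Suc (l z)"
        using graph_level_adj_le[OF conn sym] z(1) sym by (auto simp: l_def dest: sympD)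
      then have "a ^ Suc (l z) \<le> a ^ l x" using a by (intro power_decreasing) auto
      then show ?thesis using a by (simp add: w_def field_simps)
    qed
    have "w y = a * w x" if "y \<in> {y. adj x y} - {z}" for y
      using that z tree_unique_lower_neighbour[OF gt, of x y z r] by (intro upper) (auto simp: l_def)
    then have "(\<Sum>y\<in>{y. adj x y} - {z}. w y) = (\<Sum>y\<in>{y. adj x y} - {z}. a * w x)"
      by (intro sum.cong) auto
    also have "\<dots> = real d * (a * w x)" using z deg[of x] fin[of x] by simp
    finally have "(\<Sum>y | adj x y. w y) = w z + (real d * a) * w x"
      using z fin[of x] by (subst sum.remove[of _ z]) auto
    then show ?thesis using zw unfolding da by (simp add: algebra_simps)
  next
    case False
    then have "(\<Sum>y | adj x y. w y) = (\<Sum>y | adj x y. a * w x)"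
      by (intro sum.cong) (auto intro: upper)
    also have "\<dots> = (real d + 1) * a * w x" using deg[of x] by simp
    \<comment> \<open>This case is the root, whose \<open>d + 1\<close> neighbours all lie one level up; \<open>d + 1 \<le> 2 * d\<close> suffices.\<close>
    also have "\<dots> \<le> (2 * real d) * a * w x"
      using d a wpos[of x] by (intro mult_right_mono) auto
    also have "\<dots> = 2 * sqrt d * w x" using da(1) by (simp add: mult.assoc)
    finally show ?thesis .
  qed
  moreover have "2 * sqrt d = real d + 1 - (sqrt d - 1)\<^sup>2"
    by (simp add: power2_eq_square algebra_simps)
  moreover have "(sqrt d - 1)\<^sup>2 > 0"
    using d by (simp add: real_sqrt_eq_1_iff)
  ultimately show thesis using that[of "(sqrt d - 1)\<^sup>2" w] wpos by auto
qed


section \<open>Averages over the jumps of exclusion particles\<close>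

text \<open>The transposition of \<open>x\<close> and \<open>y\<close> moves a particle from \<open>x\<close> to \<open>y\<close> if \<open>y\<close> is vacant and leaves the
  occupied set unchanged if \<open>y\<close> is occupied. With \<open>\<Lambda>\<close> the number of pairs in the sum, this is the
  transition operator of the jump chain of exclusion particles, with suppressed jumps as holding
  steps. The values lie in a real vector space because the operator is applied both to real
  functions of sets and to families of functions on the configuration space.\<close>

definition stirring_mean ::
    "('v \<Rightarrow> 'v \<Rightarrow> bool) \<Rightarrow> real \<Rightarrow> ('v set \<Rightarrow> 'b::real_vector) \<Rightarrow> 'v set \<Rightarrow> 'b" where
  "stirring_mean adj \<Lambda> g A = (\<Sum>x\<in>A. \<Sum>y | adj x y. g (Transposition.transpose x y ` A)) /\<^sub>R \<Lambda>"

lemma card_transpose_image: "card (Transposition.transpose x y ` A) = card A"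
  by (simp add: card_image)

lemma stirring_mean_iter_Suc:
  "(stirring_mean adj \<Lambda> ^^ Suc k) g A = (\<Sum>x\<in>A. \<Sum>y | adj x y.
    (stirring_mean adj \<Lambda> ^^ k) g (Transposition.transpose x y ` A)) /\<^sub>R \<Lambda>"
  by (simp only: funpow.simps o_apply) (rule stirring_mean_def)

text \<open>The iterates are finite nonnegative combinations of values at sets of the same size. Any relation
  that is stable under such combinations passes from the families to their iterates; this one
  principle gives monotonicity, norm bounds, evaluation at a point and compatibility with the
  generator.\<close>

lemma stirring_mean_iter_related:
  fixes R :: "'b::real_vector \<Rightarrow> 'c::real_vector \<Rightarrow> bool"
  assumes zero: "R 0 0"
    and add: "\<And>u v u' v'. R u u' \<Longrightarrow> R v v' \<Longrightarrow> R (u + v) (u' + v')"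
    and scale: "\<And>c u u'. 0 \<le> c \<Longrightarrow> R u u' \<Longrightarrow> R (c *\<^sub>R u) (c *\<^sub>R u')"
    and "\<Lambda> \<ge> 0"
    and "\<And>B. finite B \<Longrightarrow> card B = m \<Longrightarrow> R (g B) (g' B)"
    and "finite A" "card A = m"
  shows "R ((stirring_mean adj \<Lambda> ^^ k) g A) ((stirring_mean adj \<Lambda> ^^ k) g' A)"
  using assms(6,7)
proof (induction k arbitrary: A)
  case 0
  then show ?case using assms by simp
next
  case (Suc k)
  have sum: "R (sum f X) (sum f' X)" if "\<And>x. x \<in> X \<Longrightarrow> R (f x) (f' x)"
    for X :: "'a set" and f f'
  proof (cases "finite X")
    case True
    then show ?thesis using that by (induction X) (auto intro: zero add)
  qed (simp add: zero)
  show ?case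
    unfolding stirring_mean_iter_Suc using Suc.prems \<open>\<Lambda> \<ge> 0\<close>
    by (intro scale sum Suc.IH) (simp_all add: card_transpose_image)
qed

lemma stirring_mean_mono:
  assumes "\<Lambda> \<ge> 0" "\<And>B. finite B \<Longrightarrow> card B = card A \<Longrightarrow> g B \<le> (g' B :: real)" "finite A"
  shows "stirring_mean adj \<Lambda> g A \<le> stirring_mean adj \<Lambda> g' A"
  using stirring_mean_iter_related[of "(\<le>)" \<Lambda> "card A" g g' A 1 adj] assms
  by (auto intro: add_mono mult_left_mono)

lemma stirring_mean_iter_linear:
  "(stirring_mean adj \<Lambda> ^^ k) (\<lambda>B. c *\<^sub>R (g B - h B)) A =
    c *\<^sub>R ((stirring_mean adj \<Lambda> ^^ k) g A - (stirring_mean adj \<Lambda> ^^ k) h A)"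
proof (induction k arbitrary: A)
  case (Suc k)
  then show ?case
    unfolding stirring_mean_iter_Suc
    by (simp add: sum_subtractf scaleR_right_diff_distrib mult.commute flip: scaleR_right.sum)
qed simp

lemma stirring_mean_scale:
  "stirring_mean adj \<Lambda> (\<lambda>B. c * g B) A = c * stirring_mean adj \<Lambda> g (A :: 'v set)" for c :: real
  by (simp add: stirring_mean_def mult.left_commute flip: sum_distrib_left)

text \<open>Iterating a superharmonic inequality; the transition probabilities of the chain will be bounded
  by applying this to a function that dominates an indicator.\<close>

lemma stirring_mean_iter_le_geometric:
  fixes \<phi> :: "'v set \<Rightarrow> real"
  assumes \<Lambda>: "\<Lambda> \<ge> 0" and \<rho>: "\<rho> \<ge> 0"
    and super: "\<And>B. finite B \<Longrightarrow> card B = m \<Longrightarrow> stirring_mean adj \<Lambda> \<phi> B \<le> \<rho> * \<phi> B"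
    and "finite A" "card A = m"
  shows "(stirring_mean adj \<Lambda> ^^ k) \<phi> A \<le> \<rho> ^ k * \<phi> A"
  using assms(4,5)
proof (induction k arbitrary: A)
  case (Suc k)
  have "(stirring_mean adj \<Lambda> ^^ Suc k) \<phi> A \<le> stirring_mean adj \<Lambda> (\<lambda>B. \<rho> ^ k * \<phi> B) A"
    using Suc \<Lambda> by (auto intro!: stirring_mean_mono)
  also have "\<dots> \<le> \<rho> ^ k * (\<rho> * \<phi> A)"
    unfolding stirring_mean_scale using Suc.prems super \<rho> by (intro mult_left_mono) auto
  finally show ?case by (simp add: mult_ac)
qed simp

locale regular_graph =
  fixes adj :: "'v \<Rightarrow> 'v \<Rightarrow> bool" and d :: nat
  assumes sym: "symp adj" and deg: "\<And>x. card {y. adj x y} = d + 1"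
begin

lemma finite_neighbours: "finite {y. adj x y}"
  using deg[of x] by (metis card.infinite add_is_0 one_neq_zero)

lemma adj_commute: "adj x y \<longleftrightarrow> adj y x"
  using sym by (auto dest: sympD)

lemma stirring_mean_const:
  assumes "finite A" "A \<noteq> {}"
  shows "(stirring_mean adj ((real d + 1) * card A) ^^ k) (\<lambda>_. c :: real) A = c"
proof -
  define m where "m = card A"
  have "m > 0" using assms by (auto simp: m_def card_gt_0_iff)
  then have nz: "real m + real d * real m \<noteq> 0" by (simp add: add_pos_nonneg less_imp_neq[symmetric])
  have "(stirring_mean adj ((real d + 1) * m) ^^ k) (\<lambda>_. c :: real) B = c"
    if "card B = m" for B
    using that
  proof (induction k arbitrary: B)
    case (Suc k)
    then show ?case
      unfolding stirring_mean_iter_Suc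
      by (simp add: card_transpose_image deg) (use nz in \<open>simp add: field_simps\<close>)
  qed simp
  then show ?thesis by (simp add: m_def)
qed

text \<open>If all jumps were allowed, the neighbour sums of \<open>w\<close> would give the claim particle by particle. A
  jump along an edge between occupied sites would multiply the product by \<open>w y / w x\<close>, whereas it is
  replaced by a holding step with factor \<open>1\<close>. Over both orientations of the edge the sum of the
  differences \<open>w y / w x - 1\<close> is \<open>(w x - w y)\<^sup>2 / (w x * w y) \<ge> 0\<close>, so the exclusion rule only makes
  the average smaller.\<close>

lemma stirring_mean_prod_le:
  fixes w :: "'v \<Rightarrow> real"
  assumes w: "\<And>x. w x > 0" "\<And>x. (\<Sum>y | adj x y. w y) \<le> (real d + 1 - \<kappa>) * w x"
    and A: "finite A" "A \<noteq> {}"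
  shows "stirring_mean adj ((real d + 1) * card A) (prod w) A \<le> (1 - \<kappa> / (real d + 1)) * prod w A"
proof -
  have w0: "w x \<noteq> 0" for x using w(1)[of x] by simp
  let ?c = "\<lambda>x y. w y / w x - 1"
  have moved: "prod w (Transposition.transpose x y ` A) = prod w A * (if y \<in> A then 1 else w y / w x)"
    if "x \<in> A" for x y
  proof (cases "y \<in> A")
    case True
    then show ?thesis using that transpose_image_eq[of x A y] by auto
  next
    case False
    then have "Transposition.transpose x y ` A = insert y (A - {x})"
      using that by (auto simp: Transposition.transpose_def image_iff split: if_splits)
    then show ?thesis using False A that w0[of x]
      by (simp add: prod.remove[of A x w])
  qed
  \<comment> \<open>Reversing the orientation of the edges with both ends in \<open>A\<close>.\<close>
  have flip: "(\<Sum>x\<in>A. \<Sum>y\<in>A. of_bool (adj x y) * ?c x y)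
      = (\<Sum>x\<in>A. \<Sum>y\<in>A. of_bool (adj x y) * ?c y x)"
    by (subst sum.swap) (simp add: adj_commute)
  have pair: "?c x y + ?c y x \<ge> 0" for x y
  proof -
    have "?c x y + ?c y x = (w x - w y)\<^sup>2 / (w x * w y)"
      using w0[of x] w0[of y] by (simp add: field_simps power2_eq_square)
    then show ?thesis using w(1)[of x] w(1)[of y] by simp
  qed
  have "0 \<le> (\<Sum>x\<in>A. \<Sum>y\<in>A. of_bool (adj x y) * (?c x y + ?c y x))"
    using pair by (intro sum_nonneg) auto
  also have "\<dots> = 2 * (\<Sum>x\<in>A. \<Sum>y\<in>A. of_bool (adj x y) * ?c x y)"
    unfolding distrib_left sum.distrib flip by simp
  finally have inner: "0 \<le> (\<Sum>x\<in>A. \<Sum>y\<in>A. of_bool (adj x y) * ?c x y)" by simp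
  have "(\<Sum>y\<in>A. of_bool (adj x y) * ?c x y) = (\<Sum>y | adj x y. if y \<in> A then ?c x y else 0)" for x
    using A finite_neighbours[of x] by (intro sum.mono_neutral_cong) auto
  then have "0 \<le> (\<Sum>x\<in>A. \<Sum>y | adj x y. if y \<in> A then ?c x y else 0)" using inner by simp
  then have "(\<Sum>x\<in>A. \<Sum>y | adj x y. if y \<in> A then 1 else w y / w x)
      \<le> (\<Sum>x\<in>A. \<Sum>y | adj x y. (if y \<in> A then 1 else w y / w x) + (if y \<in> A then ?c x y else 0))"
    by (simp add: sum.distrib)
  also have "\<dots> = (\<Sum>x\<in>A. (\<Sum>y | adj x y. w y) / w x)"
    unfolding sum_divide_distrib by (intro sum.cong) auto
  also have "\<dots> \<le> (\<Sum>x\<in>A. real d + 1 - \<kappa>)"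
    using w by (intro sum_mono) (simp add: divide_le_eq)
  finally have rate: "(\<Sum>x\<in>A. \<Sum>y | adj x y. if y \<in> A then 1 else w y / w x)
      \<le> card A * (real d + 1 - \<kappa>)" by simp
  have "(\<Sum>x\<in>A. \<Sum>y | adj x y. prod w (Transposition.transpose x y ` A))
      = prod w A * (\<Sum>x\<in>A. \<Sum>y | adj x y. if y \<in> A then 1 else w y / w x)"
    by (simp add: moved sum_distrib_left)
  also have "\<dots> \<le> prod w A * (card A * (real d + 1 - \<kappa>))"
    using rate w(1) by (intro mult_left_mono prod_nonneg) (auto intro: less_imp_le)
  finally have "stirring_mean adj ((real d + 1) * card A) (prod w) A
      \<le> prod w A * (card A * (real d + 1 - \<kappa>)) / ((real d + 1) * card A)"
    unfolding stirring_mean_def by (simp add: divide_right_mono divide_inverse_commute mult_left_mono)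
  also have "\<dots> = (1 - \<kappa> / (real d + 1)) * prod w A"
  proof -
    have eq: "P * (n * (D - \<kappa>)) / (D * n) = (1 - \<kappa> / D) * P" if "D \<noteq> 0" "n \<noteq> 0" for P D n :: real
      using that by (simp add: field_simps)
    show ?thesis using A by (intro eq) auto
  qed
  finally show ?thesis .
qed

end


section \<open>Uniformization of Markov semigroups\<close>

text \<open>Positivity applied to \<open>norm f \<plusminus> f\<close>.\<close>

lemma markov_semigroup_contraction:
  assumes S: "markov_semigroup S" and t: "t \<ge> 0"
  shows "norm (S t f) \<le> norm f"
proof (rule norm_bound)
  fix x
  have lin: "linear (S t)" and one: "S t (const_bcontfun 1) = const_bcontfun 1"
    and pos: "\<And>g. (\<And>x. apply_bcontfun g x \<ge> 0) \<Longrightarrow> apply_bcontfun (S t g) x \<ge> 0"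
    using S t by (auto simp: markov_semigroup_def)
  have "- norm f \<le> apply_bcontfun f y" "apply_bcontfun f y \<le> norm f" for y
    using norm_bounded[of f y] by auto
  note bounds = this
  have lower: "0 \<le> norm f + apply_bcontfun f y" for y using bounds(1)[of y] by linarith
  have "apply_bcontfun (S t (norm f *\<^sub>R const_bcontfun 1 - f)) x \<ge> 0"
    by (rule pos) (simp add: bounds)
  moreover have "apply_bcontfun (S t (norm f *\<^sub>R const_bcontfun 1 + f)) x \<ge> 0"
    by (rule pos) (simp add: lower)
  ultimately show "norm (apply_bcontfun (S t f) x) \<le> norm f"
    by (simp add: linear_diff[OF lin] linear_add[OF lin] linear_scale[OF lin] one abs_le_iff)
qed

text \<open>Contractivity reduces continuity at every time to continuity at \<open>0\<close>.\<close>

lemma markov_semigroup_diff_le: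
  assumes S: "markov_semigroup S" and "0 \<le> s" "s \<le> t"
  shows "norm (S t f - S s f) \<le> norm (S (t - s) f - f)"
proof -
  have lin: "linear (S s)" using S assms by (auto simp: markov_semigroup_def)
  have "S t f = S s (S (t - s) f)"
    using S assms(2,3) unfolding markov_semigroup_def
    by (metis diff_ge_0_iff_ge le_add_diff_inverse)
  then have "S t f - S s f = S s (S (t - s) f - f)" by (simp add: linear_diff[OF lin])
  then show ?thesis using markov_semigroup_contraction[OF S assms(2)] by simp
qed

lemma markov_semigroup_continuous:
  assumes S: "markov_semigroup S"
  shows "continuous_on {0..} (\<lambda>t. S t f)"
  unfolding continuous_on_iff
proof (intro ballI allI impI)
  fix t e :: real assume "t \<in> {0..}" "e > 0"
  have "((\<lambda>t. S t f) \<longlongrightarrow> f) (at_right 0)" using S by (simp add: markov_semigroup_def)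
  from tendstoD[OF this \<open>e > 0\<close>]
  obtain \<delta> where \<delta>: "\<delta> > 0" "\<And>h. 0 < h \<Longrightarrow> h < \<delta> \<Longrightarrow> dist (S h f) f < e"
    unfolding eventually_at_right_field by auto
  have small: "norm (S h f - f) < e" if "0 \<le> h" "h < \<delta>" for h
    using \<delta>(2)[of h] that S \<open>e > 0\<close> by (cases "h = 0") (auto simp: dist_norm markov_semigroup_def)
  have "dist (S s f) (S t f) < e" if "s \<in> {0..}" "dist s t < \<delta>" for s
  proof (cases "s \<le> t")
    case True
    then have "norm (S t f - S s f) < e"
      using markov_semigroup_diff_le[OF S, of s t f] small[of "t - s"] that by (auto simp: dist_real_def)
    then show ?thesis by (simp add: dist_norm norm_minus_commute)
  next
    case False
    then have "norm (S s f - S t f) < e"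
      using markov_semigroup_diff_le[OF S, of t s f] small[of "s - t"] that \<open>t \<in> {0..}\<close>
      by (auto simp: dist_real_def)
    then show ?thesis by (simp add: dist_norm)
  qed
  then show "\<exists>\<delta>>0. \<forall>s\<in>{0..}. dist s t < \<delta> \<longrightarrow> dist (S s f) (S t f) < e"
    using \<delta>(1) by blast
qed

text \<open>The generator gives a right derivative at \<open>0\<close>. Difference quotients at \<open>t\<close> from either side are
  images under \<open>S t\<close> or \<open>S (t - h)\<close> of the quotient at \<open>0\<close>, so contractivity controls the error and
  strong continuity identifies the limit.\<close>

lemma markov_semigroup_has_vector_derivative:
  assumes S: "markov_semigroup S" and g: "has_generator_value S f g" and t: "t > 0"
  shows "((\<lambda>t. S t f) has_vector_derivative S t g) (at t)"
proof -
  have semi: "S (s + h) f = S s (S h f)" if "s \<ge> 0" "h \<ge> 0" for s h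
    using S that by (simp add: markov_semigroup_def)
  have lin: "linear (S s)" if "s \<ge> 0" for s using S that by (simp add: markov_semigroup_def)
  \<comment> \<open>The error of the difference quotient at \<open>0\<close>.\<close>
  define q where "q h = (S h f - f) /\<^sub>R h - g" for h
  have q0: "(q \<longlongrightarrow> 0) (at_right 0)"
    using g unfolding has_generator_value_def q_def by (auto intro: tendsto_eq_intros)
  have quotient: "(S (s + h) f - S s f) /\<^sub>R h = S s g + S s (q h)" if "s \<ge> 0" "h > 0" for s h
    using that by (simp add: semi q_def linear_diff[OF lin] linear_scale[OF lin])
  have right: "((\<lambda>h. (S (t + h) f - S t f) /\<^sub>R h) \<longlongrightarrow> S t g) (at_right 0)"
  proof (rule Lim_transform_eventually)
    have "((\<lambda>h. S t (q h)) \<longlongrightarrow> 0) (at_right 0)"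
      by (rule Lim_null_comparison[OF _ tendsto_norm_zero[OF q0]])
        (use markov_semigroup_contraction[OF S] t in auto)
    then show "((\<lambda>h. S t g + S t (q h)) \<longlongrightarrow> S t g) (at_right 0)"
      by (auto intro: tendsto_eq_intros)
    show "\<forall>\<^sub>F h in at_right 0. S t g + S t (q h) = (S (t + h) f - S t f) /\<^sub>R h"
      using t quotient by (auto simp: eventually_at_right_field intro!: exI[of _ 1])
  qed
  have left: "((\<lambda>h. (S (t - h) f - S t f) /\<^sub>R (- h)) \<longlongrightarrow> S t g) (at_right 0)"
  proof (rule Lim_transform_eventually)
    have ev: "\<forall>\<^sub>F h in at_right 0. 0 < h \<and> h < t"
      using t by (auto simp: eventually_at_right_field)
    have "((\<lambda>h. S (t - h) (q h)) \<longlongrightarrow> 0) (at_right 0)"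
      by (rule Lim_null_comparison[OF _ tendsto_norm_zero[OF q0]])
        (use markov_semigroup_contraction[OF S] in \<open>auto intro: eventually_mono[OF ev]\<close>)
    moreover have "((\<lambda>h. S (t - h) g) \<longlongrightarrow> S t g) (at_right 0)"
    proof -
      have "isCont (\<lambda>t. S t g) t"
        using markov_semigroup_continuous[OF S, of g] t
        by (intro continuous_on_interior[of "{0..}"]) auto
      moreover have "((\<lambda>h. t - h) \<longlongrightarrow> t) (at_right 0)" by (auto intro: tendsto_eq_intros)
      ultimately show ?thesis using isCont_tendsto_compose by blast
    qed
    ultimately show "((\<lambda>h. S (t - h) g + S (t - h) (q h)) \<longlongrightarrow> S t g) (at_right 0)"
      by (auto intro: tendsto_eq_intros)
    show "\<forall>\<^sub>F h in at_right 0. S (t - h) g + S (t - h) (q h) = (S (t - h) f - S t f) /\<^sub>R (- h)"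
      using ev
    proof (rule eventually_mono)
      fix h assume h: "0 < h \<and> h < t"
      show "S (t - h) g + S (t - h) (q h) = (S (t - h) f - S t f) /\<^sub>R (- h)"
        using quotient[of "t - h" h] h by (simp add: scaleR_right_diff_distrib)
    qed
  qed
  have "((\<lambda>h. (S (t + h) f - S t f) /\<^sub>R h) \<longlongrightarrow> S t g) (at 0)"
    using left right by (intro filterlim_split_at) (simp_all add: filterlim_at_left_to_right)
  then have lim: "((\<lambda>h. norm ((S (t + h) f - S t f) /\<^sub>R h - S t g)) \<longlongrightarrow> 0) (at 0)"
    by (intro tendsto_norm_zero LIM_zero)
  have eq: "norm ((S (t + h) f - S t f) /\<^sub>R h - S t g)
      = norm (S (t + h) f - S t f - h *\<^sub>R S t g) / norm h" if "h \<noteq> 0" for h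
  proof -
    have "S (t + h) f - S t f - h *\<^sub>R S t g = h *\<^sub>R ((S (t + h) f - S t f) /\<^sub>R h - S t g)"
      using that by (simp add: scaleR_right_diff_distrib)
    then show ?thesis using that by (simp only: norm_scaleR) simp
  qed
  have "((\<lambda>h. norm (S (t + h) f - S t f - h *\<^sub>R S t g) / norm h) \<longlongrightarrow> 0) (at 0)"
    by (rule Lim_transform_eventually[OF lim]) (use eq in \<open>auto simp: eventually_at_filter\<close>)
  then show ?thesis
    unfolding has_vector_derivative_def has_derivative_at
    by (auto intro: bounded_linear_scaleR_left)
qed

text \<open>The functions \<open>exp (\<Lambda> * t) *\<^sub>R S t (f k)\<close> have the derivatives
  \<open>\<Lambda> *\<^sub>R (exp (\<Lambda> * t) *\<^sub>R S t (f (Suc k)))\<close>: the exponential factor cancels the diagonal part of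
  the generator. The sum is thus the Taylor polynomial at \<open>0\<close>, and the estimate is Taylor's remainder
  bound, obtained by integrating the same bound for \<open>Suc k\<close> and \<open>n\<close>.\<close>

lemma markov_semigroup_uniformization_remainder:
  assumes S: "markov_semigroup S" and \<Lambda>: "\<Lambda> > 0"
    and bound: "\<And>k. norm (f k) \<le> K"
    and gen: "\<And>k. has_generator_value S (f k) (\<Lambda> *\<^sub>R (f (Suc k) - f k))"
    and t: "0 \<le> t" "t \<le> T"
  shows "norm (exp (\<Lambda> * t) *\<^sub>R S t (f k) - (\<Sum>j<n. ((\<Lambda> * t) ^ j / fact j) *\<^sub>R f (k + j)))
    \<le> K * exp (\<Lambda> * T) * ((\<Lambda> * t) ^ n / fact n)"
  using t
proof (induction n arbitrary: k t)
  case 0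
  have "norm (exp (\<Lambda> * t) *\<^sub>R S t (f k)) \<le> exp (\<Lambda> * T) * K"
    using markov_semigroup_contraction[OF S, of t "f k"] bound[of k] 0 \<Lambda>
    by (auto intro!: mult_mono)
  then show ?case by (simp add: mult.commute)
next
  case (Suc n)
  define D where "D k s = exp (\<Lambda> * s) *\<^sub>R S s (f k)
      - (\<Sum>j<Suc n. ((\<Lambda> * s) ^ j / fact j) *\<^sub>R f (k + j))" for k s
  define D' where "D' k s = \<Lambda> *\<^sub>R (exp (\<Lambda> * s) *\<^sub>R S s (f (Suc k))
      - (\<Sum>j<n. ((\<Lambda> * s) ^ j / fact j) *\<^sub>R f (Suc k + j)))" for k s
  define \<phi> where "\<phi> s = K * exp (\<Lambda> * T) * ((\<Lambda> * s) ^ Suc n / fact (Suc n))" for s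
  have S0: "S 0 g = g" for g using S by (simp add: markov_semigroup_def)
  have D0: "D k 0 = 0" unfolding D_def by (subst sum.lessThan_Suc_shift) (simp add: S0)
  have coeff: "((\<lambda>s. (\<Lambda> * s) ^ Suc j / fact (Suc j)) has_real_derivative \<Lambda> * ((\<Lambda> * s) ^ j / fact j)) (at s)"
    for j s
  proof -
    have "((\<lambda>s. (\<Lambda> * s) ^ Suc j) has_real_derivative real (Suc j) * (\<Lambda> * s) ^ j * \<Lambda>) (at s)"
      by (auto intro!: derivative_eq_intros simp del: power_Suc)
    from DERIV_cdivide[OF this, of "fact (Suc j)"]
    have "((\<lambda>s. (\<Lambda> * s) ^ Suc j / fact (Suc j)) has_real_derivative
        real (Suc j) * ((\<Lambda> * s) ^ j * \<Lambda>) / (real (Suc j) * fact j)) (at s)"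
      by (simp only: fact_Suc mult.assoc)
    then show ?thesis by (simp only: nonzero_mult_divide_mult_cancel_left) (simp add: mult.commute)
  qed
  show ?case
  proof (cases "t = 0")
    case True
    then show ?thesis using D0 by (simp add: D_def)
  next
    case False
    have "norm (D k t - D k 0) \<le> \<phi> t - \<phi> 0"
    proof (rule differentiable_bound_general)
      show "0 < t" using False Suc.prems by simp
      show "continuous_on {0..t} (D k)"
        unfolding D_def
        by (intro continuous_intros continuous_on_subset[OF markov_semigroup_continuous[OF S]]) auto
      show "continuous_on {0..t} \<phi>" unfolding \<phi>_def by (intro continuous_intros) auto
      fix s assume s: "0 < s" "s < t"
      show "(D k has_vector_derivative D' k s) (at s)"
      proof -
        have "((\<lambda>s. exp (\<Lambda> * s) *\<^sub>R S s (f k)) has_vector_derivative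
            exp (\<Lambda> * s) *\<^sub>R S s (\<Lambda> *\<^sub>R (f (Suc k) - f k)) + (\<Lambda> * exp (\<Lambda> * s)) *\<^sub>R S s (f k)) (at s)"
          by (rule has_vector_derivative_scaleR[OF _ markov_semigroup_has_vector_derivative[OF S gen s(1)]])
            (auto intro!: derivative_eq_intros)
        moreover have "linear (S s)" using S s by (simp add: markov_semigroup_def)
        ultimately have "((\<lambda>s. exp (\<Lambda> * s) *\<^sub>R S s (f k)) has_vector_derivative
            \<Lambda> *\<^sub>R exp (\<Lambda> * s) *\<^sub>R S s (f (Suc k))) (at s)"
          by (simp add: linear_scale linear_diff algebra_simps)
        moreover have "((\<lambda>s. \<Sum>j<Suc n. ((\<Lambda> * s) ^ j / fact j) *\<^sub>R f (k + j)) has_vector_derivative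
            (\<Sum>j<n. (\<Lambda> * ((\<Lambda> * s) ^ j / fact j)) *\<^sub>R f (Suc k + j))) (at s)"
        proof (subst sum.lessThan_Suc_shift)
          have "((\<lambda>s. ((\<Lambda> * s) ^ Suc j / fact (Suc j)) *\<^sub>R f (k + Suc j)) has_vector_derivative
              (\<Lambda> * ((\<Lambda> * s) ^ j / fact j)) *\<^sub>R f (Suc k + j)) (at s)" for j
            using has_vector_derivative_scaleR[OF coeff[of j s] has_vector_derivative_const[of "f (k + Suc j)"]]
            by simp
          then have "((\<lambda>s. \<Sum>j<n. ((\<Lambda> * s) ^ Suc j / fact (Suc j)) *\<^sub>R f (k + Suc j))
              has_vector_derivative (\<Sum>j<n. (\<Lambda> * ((\<Lambda> * s) ^ j / fact j)) *\<^sub>R f (Suc k + j))) (at s)"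
            by (intro has_vector_derivative_sum)
          from has_vector_derivative_add[OF has_vector_derivative_const[of "f k"] this]
          show "((\<lambda>s. ((\<Lambda> * s) ^ 0 / fact 0) *\<^sub>R f (k + 0)
              + (\<Sum>j<n. ((\<Lambda> * s) ^ Suc j / fact (Suc j)) *\<^sub>R f (k + Suc j))) has_vector_derivative
            (\<Sum>j<n. (\<Lambda> * ((\<Lambda> * s) ^ j / fact j)) *\<^sub>R f (Suc k + j))) (at s)"
            by simp
        qed
        ultimately have "(D k has_vector_derivative \<Lambda> *\<^sub>R exp (\<Lambda> * s) *\<^sub>R S s (f (Suc k))
            - (\<Sum>j<n. (\<Lambda> * ((\<Lambda> * s) ^ j / fact j)) *\<^sub>R f (Suc k + j))) (at s)"
          unfolding D_def by (rule has_vector_derivative_diff)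
        then show ?thesis by (simp add: D'_def scaleR_right_diff_distrib scaleR_right.sum)
      qed
      show "(\<phi> has_vector_derivative K * exp (\<Lambda> * T) * (\<Lambda> * ((\<Lambda> * s) ^ n / fact n))) (at s)"
        unfolding \<phi>_def has_real_derivative_iff_has_vector_derivative[symmetric]
        by (rule DERIV_cmult[OF coeff])
      show "norm (D' k s) \<le> K * exp (\<Lambda> * T) * (\<Lambda> * ((\<Lambda> * s) ^ n / fact n))"
        using mult_left_mono[OF Suc.IH[of s "Suc k"], of \<Lambda>] s Suc.prems \<Lambda>
        by (simp add: D'_def mult_ac)
    qed
    then show ?thesis by (simp add: D0) (simp add: D_def \<phi>_def)
  qed
qed

text \<open>If \<open>f k\<close> is the \<open>k\<close>-th iterate of a contraction \<open>T\<close> and the generator is \<open>\<Lambda> (T - I)\<close>, this is the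
  expansion of \<open>exp (t \<Lambda> (T - I))\<close>; only the orbit of \<open>f 0\<close> enters.\<close>

lemma markov_semigroup_uniformization:
  assumes S: "markov_semigroup S" and \<Lambda>: "\<Lambda> > 0"
    and bound: "\<And>k. norm (f k) \<le> K"
    and gen: "\<And>k. has_generator_value S (f k) (\<Lambda> *\<^sub>R (f (Suc k) - f k))"
    and t: "0 \<le> t"
  shows "(\<lambda>k. (exp (- \<Lambda> * t) * ((\<Lambda> * t) ^ k / fact k)) *\<^sub>R f k) sums S t (f 0)"
proof -
  let ?P = "\<lambda>n. \<Sum>j<n. ((\<Lambda> * t) ^ j / fact j) *\<^sub>R f j"
  have "(\<lambda>n. (\<Lambda> * t) ^ n / fact n) \<longlonglongrightarrow> 0"
    using summable_LIMSEQ_zero[OF summable_exp[of "\<Lambda> * t"]] by (simp add: divide_inverse mult.commute)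
  then have lim: "(\<lambda>n. K * exp (\<Lambda> * t) * ((\<Lambda> * t) ^ n / fact n)) \<longlonglongrightarrow> 0"
    by (intro tendsto_mult_right_zero)
  have "(\<lambda>n. exp (\<Lambda> * t) *\<^sub>R S t (f 0) - ?P n) \<longlonglongrightarrow> 0"
    by (rule Lim_null_comparison[OF always_eventually lim])
      (use markov_semigroup_uniformization_remainder[of S \<Lambda> f K t t 0, OF S \<Lambda> bound gen t order_refl] in simp)
  from tendsto_diff[OF tendsto_const[of "exp (\<Lambda> * t) *\<^sub>R S t (f 0)"] this]
  have "?P \<longlonglongrightarrow> exp (\<Lambda> * t) *\<^sub>R S t (f 0)" by simp
  then have "(\<lambda>j. ((\<Lambda> * t) ^ j / fact j) *\<^sub>R f j) sums (exp (\<Lambda> * t) *\<^sub>R S t (f 0))"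
    by (simp add: sums_def)
  from sums_scaleR_right[OF this, of "exp (- \<Lambda> * t)"] show ?thesis
    by (simp flip: exp_add)
qed


section \<open>Centred occupation products\<close>

definition centered_product :: "real \<Rightarrow> 'v set \<Rightarrow> 'v config \<Rightarrow> real" where
  "centered_product p A \<eta> = (\<Prod>x\<in>A. of_bool (\<eta> x) - p)"

lemma centered_product_empty [simp]: "centered_product p {} \<eta> = 1"
  by (simp add: centered_product_def)

lemma centered_product_exchange:
  "centered_product p A (exchange x y \<eta>) = centered_product p (Transposition.transpose x y ` A) \<eta>"
  by (simp add: centered_product_def exchange_def prod.reindex)

lemma abs_centered_product_le_1:
  assumes "0 \<le> p" "p \<le> 1"
  shows "\<bar>centered_product p A \<eta>\<bar> \<le> 1"
  unfolding centered_product_def abs_prod using assms by (intro prod_le_1) (auto simp: of_bool_def)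

lemma local_centered_product:
  assumes "finite A"
  shows "local_fun (centered_product p A)"
  unfolding local_fun_def centered_product_def using assms
  by (intro exI[of _ A]) (auto intro!: prod.cong)

text \<open>Each edge between a vertex of \<open>A\<close> and a vertex outside is counted in the generator from both of its
  ends, which cancels the factor \<open>1/2\<close> and leaves the sum over the ends in \<open>A\<close>. Edges with both or
  no ends in \<open>A\<close> do not change the product.\<close>

lemma (in regular_graph) ssep_generator_centered_product:
  assumes A: "finite A" "A \<noteq> {}"
  defines "\<Lambda> \<equiv> (real d + 1) * card A"
  shows "ssep_generator adj (centered_product p A) \<eta> =
    \<Lambda> * (stirring_mean adj \<Lambda> (\<lambda>B. centered_product p B \<eta>) A - centered_product p A \<eta>)"
proof -
  \<comment> \<open>The increment caused by an exchange; it is symmetric and vanishes unless exactly one end is in \<open>A\<close>.\<close>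
  define s where "s x y = centered_product p (Transposition.transpose x y ` A) \<eta> - centered_product p A \<eta>" for x y
  define V where "V = A \<union> (\<Union>x\<in>A. {y. adj x y})"
  have finV: "finite V" using A finite_neighbours by (auto simp: V_def)
  have s_commute: "s x y = s y x" for x y by (simp add: s_def transpose_commute)
  have s_0: "s x y = 0" if "x \<in> A \<longleftrightarrow> y \<in> A" for x y
    using that by (simp add: s_def transpose_image_eq)
  have outer: "(\<Sum>y | adj x y. s x y) = (\<Sum>y\<in>A. of_bool (adj x y) * s y x)" if "x \<notin> A" for x
    using that A finite_neighbours[of x]
    by (intro sum.mono_neutral_cong) (auto simp: s_0 s_commute)
  have "(\<Sum>\<^sub>\<infinity>x. \<Sum>y | adj x y. s x y) = (\<Sum>x\<in>V. \<Sum>y | adj x y. s x y)"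
  proof -
    have "(\<Sum>y | adj x y. s x y) = 0" if "x \<notin> V" for x
    proof (rule sum.neutral, clarify)
      fix y assume "adj x y"
      then show "s x y = 0" using that by (intro s_0) (auto simp: V_def adj_commute)
    qed
    then have "(\<Sum>\<^sub>\<infinity>x. \<Sum>y | adj x y. s x y) = (\<Sum>\<^sub>\<infinity>x\<in>V. \<Sum>y | adj x y. s x y)"
      by (intro infsum_cong_neutral) auto
    then show ?thesis using finV by simp
  qed
  also have "\<dots> = (\<Sum>x\<in>A. \<Sum>y | adj x y. s x y) + (\<Sum>x\<in>V - A. \<Sum>y | adj x y. s x y)"
    using finV by (subst sum.subset_diff[of A]) (auto simp: V_def)
  also have "(\<Sum>x\<in>V - A. \<Sum>y | adj x y. s x y) = (\<Sum>y\<in>A. \<Sum>x\<in>V - A. of_bool (adj x y) * s y x)"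
    by (subst sum.swap) (simp add: outer)
  also have "\<dots> = (\<Sum>y\<in>A. \<Sum>x | adj y x. s y x)"
  proof (rule sum.cong[OF refl])
    fix y assume "y \<in> A"
    then show "(\<Sum>x\<in>V - A. of_bool (adj x y) * s y x) = (\<Sum>x | adj y x. s y x)"
      using finV finite_neighbours[of y]
      by (intro sum.mono_neutral_cong) (auto simp: V_def adj_commute[of y] intro!: s_0)
  qed
  finally have "ssep_generator adj (centered_product p A) \<eta> = (\<Sum>x\<in>A. \<Sum>y | adj x y. s x y)"
    unfolding ssep_generator_def centered_product_exchange by (simp add: s_def)
  also have "\<dots> = (\<Sum>x\<in>A. \<Sum>y | adj x y. centered_product p (Transposition.transpose x y ` A) \<eta>)
      - \<Lambda> * centered_product p A \<eta>"
    by (simp add: s_def sum_subtractf deg \<Lambda>_def)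
  also have "(\<Sum>x\<in>A. \<Sum>y | adj x y. centered_product p (Transposition.transpose x y ` A) \<eta>)
      = \<Lambda> * stirring_mean adj \<Lambda> (\<lambda>B. centered_product p B \<eta>) A"
  proof -
    have "\<Lambda> \<noteq> 0" using A by (simp add: \<Lambda>_def)
    then show ?thesis by (simp add: stirring_mean_def)
  qed
  finally show ?thesis by (simp add: right_diff_distrib)
qed

lemma centered_product_insert:
  assumes "finite A" "x \<notin> A"
  shows "centered_product p (insert x A) \<eta> = (of_bool (\<eta> x) - p) * centered_product p A \<eta>"
  using assms by (simp add: centered_product_def)

text \<open>Conditioning on one coordinate writes \<open>f\<close> as \<open>(\<eta> x - p) * (f\<^sub>1 - f\<^sub>0) + (p * f\<^sub>1 + (1 - p) * f\<^sub>0)\<close>,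
  where \<open>f\<^sub>1\<close> and \<open>f\<^sub>0\<close> are \<open>f\<close> with the value at \<open>x\<close> fixed to 1 and 0.\<close>

lemma local_fun_centered_expansion:
  assumes "finite A" and "\<And>\<eta> \<zeta>. (\<And>x. x \<in> A \<Longrightarrow> \<eta> x = \<zeta> x) \<Longrightarrow> f \<eta> = f \<zeta>"
  shows "\<exists>c. f = (\<lambda>\<eta>. \<Sum>B\<in>Pow A. c B * centered_product p B \<eta>)"
  using assms
proof (induction A arbitrary: f rule: finite_induct)
  case empty
  have "f = (\<lambda>\<eta>. \<Sum>B\<in>Pow {}. f undefined * centered_product p B \<eta>)"
    by (rule ext) (use empty in \<open>auto intro!: empty\<close>)
  then show ?case by (intro exI[of _ "\<lambda>_. f undefined"])
next
  case (insert x A)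
  have "\<exists>c. (\<lambda>\<eta>. f (\<eta>(x := b))) = (\<lambda>\<eta>. \<Sum>B\<in>Pow A. c B * centered_product p B \<eta>)" for b
    by (rule insert.IH) (auto intro!: insert.prems)
  then obtain c where c: "\<And>b. (\<lambda>\<eta>. f (\<eta>(x := b))) = (\<lambda>\<eta>. \<Sum>B\<in>Pow A. c b B * centered_product p B \<eta>)"
    by metis
  \<comment> \<open>Sets with \<open>x\<close> collect the coefficients of \<open>f\<^sub>1 - f\<^sub>0\<close>, the others those of \<open>p * f\<^sub>1 + (1 - p) * f\<^sub>0\<close>.\<close>
  define c' where "c' B = (if x \<in> B then c True (B - {x}) - c False (B - {x})
      else p * c True B + (1 - p) * c False B)" for B
  have "f \<eta> = (\<Sum>B\<in>Pow (insert x A). c' B * centered_product p B \<eta>)" for \<eta>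
  proof -
    define g where "g b = f (\<eta>(x := b))" for b
    have g: "g b = (\<Sum>B\<in>Pow A. c b B * centered_product p B \<eta>)" for b
      using fun_cong[OF c[of b], of \<eta>] by (simp add: g_def)
    have xB: "x \<notin> B" "finite B" if "B \<in> Pow A" for B
      using that insert.hyps finite_subset by auto
    have "inj_on (insert x) (Pow A)" using insert.hyps(2) by (auto simp: inj_on_def)
    then have "(\<Sum>B\<in>Pow (insert x A). c' B * centered_product p B \<eta>)
        = (\<Sum>B\<in>Pow A. c' B * centered_product p B \<eta>)
          + (\<Sum>B\<in>Pow A. c' (insert x B) * centered_product p (insert x B) \<eta>)"
      unfolding Pow_insert using insert.hyps
      by (subst sum.union_disjoint) (auto simp: sum.reindex)
    also have "(\<Sum>B\<in>Pow A. c' B * centered_product p B \<eta>) = p * g True + (1 - p) * g False"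
      unfolding g sum_distrib_left sum.distrib[symmetric] using xB
      by (intro sum.cong) (auto simp: c'_def algebra_simps)
    also have "(\<Sum>B\<in>Pow A. c' (insert x B) * centered_product p (insert x B) \<eta>)
        = (of_bool (\<eta> x) - p) * (g True - g False)"
      unfolding g right_diff_distrib sum_distrib_left sum_subtractf[symmetric] using xB
      by (intro sum.cong) (auto simp: c'_def centered_product_insert algebra_simps)
    finally have "(\<Sum>B\<in>Pow (insert x A). c' B * centered_product p B \<eta>)
        = of_bool (\<eta> x) * g True + (1 - of_bool (\<eta> x)) * g False"
      by (simp add: algebra_simps)
    also have "\<dots> = g (\<eta> x)" by (cases "\<eta> x") simp_all
    also have "\<dots> = f \<eta>" by (simp add: g_def)
    finally show ?thesis ..
  qed
  then show ?case by (intro exI[of _ c']) auto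
qed

lemma space_config_space [simp]: "space config_space = UNIV"
  by (simp add: config_space_def space_PiM)

lemma sets_bernoulli_product [simp, measurable_cong]:
  "sets (bernoulli_product p) = sets config_space"
  unfolding bernoulli_product_def config_space_def by (intro sets_PiM_cong) auto

lemma space_bernoulli_product [simp]: "space (bernoulli_product p) = UNIV"
  using sets_eq_imp_space_eq[OF sets_bernoulli_product] by simp

lemma prob_space_bernoulli_product: "prob_space (bernoulli_product p)"
  unfolding bernoulli_product_def by (intro prob_space_PiM prob_space_measure_pmf)

lemma measurable_centered_product [measurable]:
  "centered_product p A \<in> borel_measurable config_space"
proof -
  have "(\<lambda>\<eta>::'a config. \<eta> x) \<in> config_space \<rightarrow>\<^sub>M count_space UNIV" for x
    unfolding config_space_def by simp
  then have "(\<lambda>\<eta>::'a config. of_bool (\<eta> x) - p) \<in> borel_measurable config_space" for x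
    by (rule measurable_compose) simp
  then show ?thesis unfolding centered_product_def[abs_def] by (intro borel_measurable_prod)
qed

lemma measurable_local_fun:
  assumes "local_fun f"
  shows "f \<in> borel_measurable config_space"
proof -
  obtain A where "finite A" "\<And>\<eta> \<zeta>. (\<And>x. x \<in> A \<Longrightarrow> \<eta> x = \<zeta> x) \<Longrightarrow> f \<eta> = f \<zeta>"
    using assms unfolding local_fun_def by metis
  then obtain c where "f = (\<lambda>\<eta>. \<Sum>B\<in>Pow A. c B * centered_product 0 B \<eta>)"
    using local_fun_centered_expansion[of A f 0] by blast
  then show ?thesis by simp
qed

lemma integral_bernoulli_product_prod:
  assumes p: "0 \<le> p" "p \<le> 1" and A: "finite A"
  shows "(\<integral>\<eta>. (\<Prod>x\<in>A. g x (\<eta> x)) \<partial>bernoulli_product p)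
    = (\<Prod>x\<in>A. p * g x True + (1 - p) * g x False :: real)"
proof -
  let ?B = "\<lambda>_ :: 'a. measure_pmf (bernoulli_pmf p)"
  interpret product_prob_space ?B UNIV
    by unfold_locales
  have "(\<integral>\<eta>. (\<Prod>x\<in>A. g x (\<eta> x)) \<partial>bernoulli_product p)
      = (\<integral>\<eta>. (\<Prod>x\<in>A. g x (restrict \<eta> A x)) \<partial>PiM UNIV ?B)"
    unfolding bernoulli_product_def by (intro Bochner_Integration.integral_cong prod.cong) auto
  also have "\<dots> = (\<integral>\<eta>. (\<Prod>x\<in>A. g x (\<eta> x)) \<partial>distr (PiM UNIV ?B) (PiM A ?B) (\<lambda>\<eta>. restrict \<eta> A))"
    by (subst integral_distr) (auto intro!: borel_measurable_prod measurable_restrict)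
  also have "\<dots> = (\<integral>\<eta>. (\<Prod>x\<in>A. g x (\<eta> x)) \<partial>PiM A ?B)"
    by (subst distr_PiM_restrict_finite) (use A in auto)
  also have "\<dots> = (\<Prod>x\<in>A. p * g x True + (1 - p) * g x False)"
  proof (subst product_integral_prod)
    show "(\<Prod>x\<in>A. measure_pmf.expectation (bernoulli_pmf p) (g x))
        = (\<Prod>x\<in>A. p * g x True + (1 - p) * g x False)"
      using p by (simp add: mult.commute)
  qed (use A in \<open>auto intro!: integrable_measure_pmf_finite\<close>)
  finally show ?thesis .
qed

text \<open>The factor of a vertex that lies in exactly one of the two sets has mean \<open>0\<close>, and the factor of a
  common vertex has mean \<open>p * (1 - p)\<close>.\<close>

lemma integral_centered_product_mult:
  assumes p: "0 \<le> p" "p \<le> 1" and A: "finite A" "finite B"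
  shows "(\<integral>\<eta>. centered_product p A \<eta> * centered_product p B \<eta> \<partial>bernoulli_product p)
    = (if A = B then (p * (1 - p)) ^ card A else 0)"
proof -
  let ?g = "\<lambda>x b. (if x \<in> A then of_bool b - p else 1) * (if x \<in> B then of_bool b - p else 1)"
  have "centered_product p A \<eta> * centered_product p B \<eta> = (\<Prod>x\<in>A \<union> B. ?g x (\<eta> x))" for \<eta>
    unfolding centered_product_def prod.distrib using A
    by (intro arg_cong2[of _ _ _ _ times]) (auto intro!: prod.mono_neutral_cong_left)
  then have eq: "(\<integral>\<eta>. centered_product p A \<eta> * centered_product p B \<eta> \<partial>bernoulli_product p)
      = (\<Prod>x\<in>A \<union> B. p * ?g x True + (1 - p) * ?g x False)"
    using integral_bernoulli_product_prod[OF p, of "A \<union> B" ?g] A by simp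
  show ?thesis
  proof (cases "A = B")
    case True
    have "p * ?g x True + (1 - p) * ?g x False = p * (1 - p)" if "x \<in> A" for x
      using that True by (simp add: algebra_simps)
    then show ?thesis unfolding eq using True by simp
  next
    case False
    then obtain x where "x \<in> A \<union> B" "x \<in> A \<longleftrightarrow> x \<notin> B" by blast
    then have "p * ?g x True + (1 - p) * ?g x False = 0" by (auto simp: algebra_simps)
    with \<open>x \<in> A \<union> B\<close> have "\<exists>x\<in>A \<union> B. p * ?g x True + (1 - p) * ?g x False = 0" by (rule rev_bexI)
    then have "(\<Prod>x\<in>A \<union> B. p * ?g x True + (1 - p) * ?g x False) = 0"
      using A by (intro prod_zero) simp_all
    then show ?thesis unfolding eq using False by simp
  qed
qed

lemma integrable_centered_product_mult:
  assumes p: "0 \<le> p" "p \<le> 1"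
  shows "integrable (bernoulli_product p) (\<lambda>\<eta>. centered_product p A \<eta> * centered_product p B \<eta>)"
proof -
  interpret prob_space "bernoulli_product p :: 'a config measure" by (rule prob_space_bernoulli_product)
  show ?thesis
    by (rule integrable_const_bound[of _ 1])
      (use abs_centered_product_le_1[OF p] in \<open>auto simp: abs_mult intro!: AE_I2 mult_le_one\<close>)
qed

lemma has_bochner_integral_stirring_mean_iter:
  fixes g :: "'v set \<Rightarrow> 'a \<Rightarrow> real"
  assumes "\<And>B. finite B \<Longrightarrow> card B = m \<Longrightarrow> has_bochner_integral N (g B) (v B)"
    and "finite A" "card A = m"
  shows "has_bochner_integral N (\<lambda>\<zeta>. (stirring_mean adj \<Lambda> ^^ k) (\<lambda>B. g B \<zeta>) A)
    ((stirring_mean adj \<Lambda> ^^ k) v A)"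
  using assms(2,3)
proof (induction k arbitrary: A)
  case 0
  then show ?case using assms(1) by simp
next
  case (Suc k)
  show ?case unfolding stirring_mean_iter_Suc real_scaleR_def
    by (intro has_bochner_integral_mult_right has_bochner_integral_sum Suc.IH)
      (use Suc.prems in \<open>auto simp: card_transpose_image\<close>)
qed


section \<open>Decay of correlations under the exclusion semigroup\<close>

lemma bounded_linear_apply_bcontfun: "bounded_linear (\<lambda>f. apply_bcontfun f x)"
  by (rule bounded_linear_intro[of _ 1]) (use norm_bounded in auto)

context regular_graph
begin

text \<open>The iterates of the averaging operator on the family of centred products form an orbit to which
  uniformization applies. The total jump rate \<open>\<Lambda>\<close> depends only on the number of particles, which is
  constant along the orbit.\<close>

lemma ssep_semigroup_centered_product:
  fixes \<zeta> :: "'v config"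
  assumes p: "0 \<le> p" "p \<le> 1" and S: "ssep_semigroup adj S"
    and A: "finite A" "A \<noteq> {}" and f: "apply_bcontfun f = centered_product p A" and t: "t \<ge> 0"
  defines "\<Lambda> \<equiv> (real d + 1) * card A"
  shows "(\<lambda>k. exp (- \<Lambda> * t) * ((\<Lambda> * t) ^ k / fact k)
      * (stirring_mean adj \<Lambda> ^^ k) (\<lambda>B. centered_product p B \<zeta>) A) sums apply_bcontfun (S t f) \<zeta>"
proof -
  define m where "m = card A"
  have m: "m > 0" using A by (simp add: m_def card_gt_0_iff)
  then have \<Lambda>: "\<Lambda> > 0" by (simp add: \<Lambda>_def m_def)
  have "\<exists>g. apply_bcontfun g = centered_product p B" if "finite B" for B :: "'v set"
    using S local_centered_product[OF that] by (auto simp: ssep_semigroup_def)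
  then obtain D where D: "\<And>B :: 'v set. finite B \<Longrightarrow> apply_bcontfun (D B) = centered_product p B"
    by metis
  let ?T = "\<lambda>k. (stirring_mean adj \<Lambda> ^^ k)"
  have apply_iter: "apply_bcontfun (?T k D B) \<zeta> = ?T k (\<lambda>B. centered_product p B \<zeta>) B"
    if "finite B" "card B = m" for k B \<zeta>
    by (rule stirring_mean_iter_related[where m = m]) (use D that \<Lambda> in auto)
  have gen: "has_generator_value S (D B) (\<Lambda> *\<^sub>R (?T 1 D B - D B))" if B: "finite B" "card B = m" for B
  proof -
    have "B \<noteq> {}" using B m by auto
    obtain g h where gh: "apply_bcontfun g = centered_product p B"
      "apply_bcontfun h = ssep_generator adj (centered_product p B)" "has_generator_value S g h"
      using S local_centered_product[OF B(1), of p] unfolding ssep_semigroup_def by blast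
    have "g = D B" using gh(1) D[OF B(1)] by (intro bcontfun_eqI) simp
    moreover have "h = \<Lambda> *\<^sub>R (?T 1 D B - D B)"
      by (rule bcontfun_eqI)
        (use gh(2) ssep_generator_centered_product[OF B(1) \<open>B \<noteq> {}\<close>] apply_iter[OF B, of 1] B D
          in \<open>simp add: \<Lambda>_def m_def\<close>)
    ultimately show ?thesis using gh(3) by simp
  qed
  have gen_iter: "has_generator_value S (?T k D A) (\<Lambda> *\<^sub>R (?T (Suc k) D A - ?T k D A))" for k
  proof -
    have S': "linear (S t)" if "t \<ge> 0" for t
      using S that by (simp add: ssep_semigroup_def markov_semigroup_def)
    have ev: "\<forall>\<^sub>F t in at_right 0. (0::real) \<le> t"
      by (auto simp: eventually_at_right_field intro!: exI[of _ 1])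
    have "has_generator_value S (?T k D A) (?T k (\<lambda>B. \<Lambda> *\<^sub>R (?T 1 D B - D B)) A)"
    proof (rule stirring_mean_iter_related[where m = m])
      show "has_generator_value S 0 0"
        unfolding has_generator_value_def
        by (rule tendsto_eventually) (rule eventually_mono[OF ev], simp add: linear_0[OF S'])
      show "has_generator_value S (u + v) (u' + v')"
        if "has_generator_value S u u'" "has_generator_value S v v'" for u v u' v'
        unfolding has_generator_value_def
        by (rule Lim_transform_eventually[OF tendsto_add[OF that[unfolded has_generator_value_def]]])
          (rule eventually_mono[OF ev], simp add: linear_add[OF S'] algebra_simps)
      show "has_generator_value S (c *\<^sub>R u) (c *\<^sub>R u')" if "has_generator_value S u u'" for c u u'
        unfolding has_generator_value_def
        by (rule Lim_transform_eventually[OF tendsto_scaleR[OF tendsto_const that[unfolded has_generator_value_def]]])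
          (rule eventually_mono[OF ev], simp add: linear_scale[OF S'] algebra_simps)
    qed (use gen A \<Lambda> m_def in auto)
    then show ?thesis
      unfolding stirring_mean_iter_linear by (simp add: funpow_swap1)
  qed
  have norm_D: "norm (D B) \<le> 1" if "finite B" for B
    by (rule norm_bound) (use D[OF that] abs_centered_product_le_1[OF p] in auto)
  have bound: "norm (?T k D A) \<le> 1" for k
  proof -
    have "norm (?T k D A) \<le> ?T k (\<lambda>_. 1 :: real) A"
      by (rule stirring_mean_iter_related[where m = m and R = "\<lambda>u v. norm u \<le> v"])
        (use norm_D A \<Lambda> m_def in \<open>auto intro: norm_triangle_mono mult_left_mono\<close>)
    then show ?thesis using stirring_mean_const[OF A] by (simp add: \<Lambda>_def)
  qed
  have MS: "markov_semigroup S" using S by (simp add: ssep_semigroup_def)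
  have "D A = f" using f D[OF A(1)] by (intro bcontfun_eqI) simp
  with markov_semigroup_uniformization[of S \<Lambda> "\<lambda>k. ?T k D A" 1 t, OF MS \<Lambda> bound gen_iter t]
  have "(\<lambda>k. (exp (- \<Lambda> * t) * ((\<Lambda> * t) ^ k / fact k)) *\<^sub>R ?T k D A) sums S t f" by simp
  from bounded_linear.sums[OF bounded_linear_apply_bcontfun this, of \<zeta>] show ?thesis
    using apply_iter A m_def by simp
qed

lemma abs_stirring_mean_centered_product_le_1:
  assumes p: "0 \<le> p" "p \<le> 1" and A: "finite A" "A \<noteq> {}"
  shows "\<bar>(stirring_mean adj ((real d + 1) * card A) ^^ k) (\<lambda>B. centered_product p B \<zeta>) A\<bar> \<le> 1"
proof -
  have "\<bar>(stirring_mean adj ((real d + 1) * card A) ^^ k) (\<lambda>B. centered_product p B \<zeta>) A\<bar>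
      \<le> (stirring_mean adj ((real d + 1) * card A) ^^ k) (\<lambda>_. 1) A"
    by (rule stirring_mean_iter_related[where m = "card A" and R = "\<lambda>u v. \<bar>u\<bar> \<le> v"])
      (use A abs_centered_product_le_1[OF p] in \<open>auto simp: abs_mult intro: mult_left_mono\<close>)
  then show ?thesis using stirring_mean_const[OF A] by simp
qed

lemma measurable_ssep_semigroup_centered_product:
  assumes p: "0 \<le> p" "p \<le> 1" and S: "ssep_semigroup adj S"
    and A: "finite A" "A \<noteq> {}" and f: "apply_bcontfun f = centered_product p A" and t: "t \<ge> 0"
  shows "apply_bcontfun (S t f) \<in> borel_measurable config_space"
proof -
  have meas: "(\<lambda>\<zeta>. (stirring_mean adj \<Lambda> ^^ k) (\<lambda>B. centered_product p B \<zeta>) B')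
      \<in> borel_measurable config_space" for \<Lambda> k B'
    by (induction k arbitrary: B') (simp, unfold stirring_mean_iter_Suc, measurable)
  show ?thesis
    by (rule borel_measurable_LIMSEQ_real[OF ssep_semigroup_centered_product[OF assms, unfolded sums_def]])
      (use meas in measurable)
qed

text \<open>Pairing the uniformization series with the product over \<open>B\<close> and using orthogonality leaves the
  iterates of a multiple of the indicator of \<open>B\<close>, that is, multiples of the transition probabilities
  from \<open>A\<close> to \<open>B\<close>. The terms are dominated by Poisson weights, which justifies integrating term by
  term.\<close>

lemma integral_ssep_semigroup_centered_product:
  assumes p: "0 \<le> p" "p \<le> 1" and S: "ssep_semigroup adj S"
    and A: "finite A" "A \<noteq> {}" and B: "finite B"
    and f: "apply_bcontfun f = centered_product p A" and t: "t \<ge> 0"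
  defines "\<Lambda> \<equiv> (real d + 1) * card A"
  shows "(\<lambda>k. exp (- \<Lambda> * t) * ((\<Lambda> * t) ^ k / fact k)
      * (stirring_mean adj \<Lambda> ^^ k) (\<lambda>C. if B = C then (p * (1 - p)) ^ card B else 0) A)
    sums (\<integral>\<zeta>. centered_product p B \<zeta> * apply_bcontfun (S t f) \<zeta> \<partial>bernoulli_product p)"
proof -
  interpret prob_space "bernoulli_product p :: 'v config measure" by (rule prob_space_bernoulli_product)
  define a where "a k = exp (- \<Lambda> * t) * ((\<Lambda> * t) ^ k / fact k)" for k
  define Q where "Q k \<zeta> = (stirring_mean adj \<Lambda> ^^ k) (\<lambda>C. centered_product p C \<zeta>) A" for k \<zeta>
  define v where "v C = (if B = C then (p * (1 - p)) ^ card B else 0)" for C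
  let ?h = "\<lambda>k \<zeta>. a k * (centered_product p B \<zeta> * Q k \<zeta>)"
  have a0: "a k \<ge> 0" for k using t by (simp add: a_def \<Lambda>_def)
  have sum_a: "summable a"
    unfolding a_def using summable_exp[of "\<Lambda> * t"] by (intro summable_mult) (simp add: divide_inverse mult.commute)
  have Q1: "\<bar>centered_product p B \<zeta> * Q k \<zeta>\<bar> \<le> 1" for k \<zeta>
    unfolding abs_mult Q_def \<Lambda>_def
    by (intro mult_le_one abs_centered_product_le_1 abs_stirring_mean_centered_product_le_1 p A) simp
  have scaled: "centered_product p B \<zeta> * Q k \<zeta>
      = (stirring_mean adj \<Lambda> ^^ k) (\<lambda>C. centered_product p B \<zeta> * centered_product p C \<zeta>) A" for k \<zeta>
    using stirring_mean_iter_linear[of k adj \<Lambda> "centered_product p B \<zeta>" "\<lambda>C. centered_product p C \<zeta>" "\<lambda>_. 0" A]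
      stirring_mean_iter_linear[of k adj \<Lambda> 0 "\<lambda>_. 0" "\<lambda>_. 0 :: real" A]
    by (simp add: Q_def)
  have hb: "has_bochner_integral (bernoulli_product p) (\<lambda>\<zeta>. centered_product p B \<zeta> * Q k \<zeta>)
      ((stirring_mean adj \<Lambda> ^^ k) v A)" for k
    unfolding scaled
    by (rule has_bochner_integral_stirring_mean_iter[where m = "card A"])
      (use A B integral_centered_product_mult[OF p] integrable_centered_product_mult[OF p]
        in \<open>auto simp: has_bochner_integral_iff v_def\<close>)
  have h_le: "norm (?h k \<zeta>) \<le> a k" for k \<zeta>
    using mult_left_mono[OF Q1[of \<zeta> k] a0[of k]] a0[of k] by (simp add: abs_mult)
  have int: "integrable (bernoulli_product p) (?h k)" for k
    using hb[of k] by (auto simp: has_bochner_integral_iff)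
  have "summable (\<lambda>k. \<integral>\<zeta>. norm (?h k \<zeta>) \<partial>bernoulli_product p)"
  proof (rule summable_comparison_test'[OF sum_a])
    fix k
    have "(\<integral>\<zeta>. norm (?h k \<zeta>) \<partial>bernoulli_product p) \<le> (\<integral>\<zeta>. a k \<partial>(bernoulli_product p :: 'v config measure))"
      by (intro integral_mono integrable_norm int h_le) simp
    then show "norm (\<integral>\<zeta>. norm (?h k \<zeta>) \<partial>bernoulli_product p) \<le> a k" using prob_space by simp
  qed
  moreover have "summable (\<lambda>k. norm (?h k \<zeta>))" for \<zeta>
    by (rule summable_comparison_test'[OF sum_a]) (use h_le in simp)
  ultimately have total: "(\<lambda>k. \<integral>\<zeta>. ?h k \<zeta> \<partial>bernoulli_product p) sums (\<integral>\<zeta>. (\<Sum>k. ?h k \<zeta>) \<partial>bernoulli_product p)"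
    by (intro sums_integral int) auto
  have series: "(\<Sum>k. ?h k \<zeta>) = centered_product p B \<zeta> * apply_bcontfun (S t f) \<zeta>" for \<zeta>
  proof -
    have "(\<lambda>k. a k * Q k \<zeta>) sums apply_bcontfun (S t f) \<zeta>"
      using ssep_semigroup_centered_product[OF p S A f t, of \<zeta>] by (simp add: a_def Q_def \<Lambda>_def)
    from sums_mult[OF this, of "centered_product p B \<zeta>"] show ?thesis
      by (simp add: sums_iff mult.left_commute)
  qed
  have "(\<integral>\<zeta>. ?h k \<zeta> \<partial>bernoulli_product p) = a k * (stirring_mean adj \<Lambda> ^^ k) v A" for k
    using hb[of k] by (auto simp: has_bochner_integral_iff)
  then have "(\<lambda>k. a k * (stirring_mean adj \<Lambda> ^^ k) v A)
      sums (\<integral>\<zeta>. centered_product p B \<zeta> * apply_bcontfun (S t f) \<zeta> \<partial>bernoulli_product p)"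
    using total by (simp only: series)
  then show ?thesis by (simp only: a_def v_def[abs_def])
qed

text \<open>The case of the empty set \<open>B\<close>: a nonempty set of particles never becomes empty. This is the
  invariance of the Bernoulli measure.\<close>

lemma integral_ssep_semigroup_centered_product_eq_0:
  assumes p: "0 \<le> p" "p \<le> 1" and S: "ssep_semigroup adj S"
    and A: "finite A" "A \<noteq> {}"
    and f: "apply_bcontfun f = centered_product p A" and t: "t \<ge> 0"
  shows "(\<integral>\<zeta>. apply_bcontfun (S t f) \<zeta> \<partial>bernoulli_product p) = 0"
proof -
  let ?\<Lambda> = "(real d + 1) * card A"
  have "card A > 0" using A by (simp add: card_gt_0_iff)
  then have "(stirring_mean adj ?\<Lambda> ^^ k) (\<lambda>C. if {} = C then (p * (1 - p)) ^ card ({} :: 'v set) else 0) A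
      = (stirring_mean adj ?\<Lambda> ^^ k) (\<lambda>_. 0 :: real) A" for k
    by (intro stirring_mean_iter_related[where m = "card A" and R = "(=)"]) (use A in auto)
  then have "(stirring_mean adj ?\<Lambda> ^^ k) (\<lambda>C. if {} = C then (p * (1 - p)) ^ card ({} :: 'v set) else 0) A = (0 :: real)" for k
    using stirring_mean_const[OF A, of k 0] by simp
  with integral_ssep_semigroup_centered_product[OF p S A finite.emptyI f t] show ?thesis
    by (simp add: sums_iff)
qed

text \<open>The indicator of \<open>B\<close> lies below \<open>prod w C / prod w B\<close> as a function of \<open>C\<close>, and each step of the
  chain multiplies this bound by \<open>\<rho> = 1 - \<kappa> / (d + 1)\<close>. Summation against the Poisson weights gives
  \<open>exp (- \<Lambda> * (1 - \<rho>) * t)\<close> with \<open>\<Lambda> * (1 - \<rho>) = card A * \<kappa> \<ge> \<kappa>\<close>.\<close>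

lemma integral_ssep_semigroup_centered_product_bounds:
  fixes w :: "'v \<Rightarrow> real"
  assumes p: "0 \<le> p" "p \<le> 1" and S: "ssep_semigroup adj S"
    and w: "\<And>x. w x > 0" "\<And>x. (\<Sum>y | adj x y. w y) \<le> (real d + 1 - \<kappa>) * w x" and \<kappa>: "\<kappa> \<ge> 0"
    and A: "finite A" "A \<noteq> {}" and B: "finite B"
    and f: "apply_bcontfun f = centered_product p A" and t: "t \<ge> 0"
  shows "\<bar>\<integral>\<zeta>. centered_product p B \<zeta> * apply_bcontfun (S t f) \<zeta> \<partial>bernoulli_product p\<bar>
    \<le> prod w A / prod w B * exp (- \<kappa> * t)"
proof -
  define \<Lambda> where "\<Lambda> = (real d + 1) * card A"
  define \<rho> where "\<rho> = 1 - \<kappa> / (real d + 1)"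
  define v where "v C = (if B = C then (p * (1 - p)) ^ card B else 0)" for C
  define \<phi> where "\<phi> C = prod w C / prod w B" for C
  have w_pos: "prod w C > 0" for C using w(1) by (simp add: prod_pos)
  have "\<Lambda> \<ge> 0" by (simp add: \<Lambda>_def)
  \<comment> \<open>Positivity of \<open>w\<close> forces \<open>\<kappa> \<le> d + 1\<close>.\<close>
  have \<rho>: "\<rho> \<ge> 0"
  proof -
    obtain x where "x \<in> A" using A by blast
    have "0 \<le> (\<Sum>y | adj x y. w y)" using w(1) by (intro sum_nonneg) (auto intro: less_imp_le)
    also have "\<dots> \<le> (real d + 1 - \<kappa>) * w x" by (rule w)
    finally have "real d + 1 - \<kappa> \<ge> 0" using w(1)[of x] by (simp add: zero_le_mult_iff)
    then show ?thesis by (simp add: \<rho>_def)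
  qed
  have v: "0 \<le> v C" "v C \<le> \<phi> C" for C
    using p w_pos[of B] w_pos[of C] by (auto simp: v_def \<phi>_def intro!: power_le_one mult_le_one)
  have super: "stirring_mean adj \<Lambda> \<phi> C \<le> \<rho> * \<phi> C" if "finite C" "card C = card A" for C
  proof -
    have "C \<noteq> {}" using that A by auto
    have "stirring_mean adj \<Lambda> \<phi> C = stirring_mean adj \<Lambda> (prod w) C / prod w B"
      using stirring_mean_scale[of adj \<Lambda> "1 / prod w B" "prod w" C] by (simp add: \<phi>_def[abs_def])
    also have "\<dots> \<le> \<rho> * prod w C / prod w B"
      using stirring_mean_prod_le[OF w that(1) \<open>C \<noteq> {}\<close>] that(2) w_pos[of B]
      by (intro divide_right_mono) (auto simp: \<Lambda>_def \<rho>_def)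
    finally show ?thesis by (simp add: \<phi>_def)
  qed
  have iter_le: "(stirring_mean adj \<Lambda> ^^ k) v A \<le> \<rho> ^ k * \<phi> A" for k
  proof -
    have "(stirring_mean adj \<Lambda> ^^ k) v A \<le> (stirring_mean adj \<Lambda> ^^ k) \<phi> A"
      by (rule stirring_mean_iter_related[where m = "card A"])
        (use A v \<open>\<Lambda> \<ge> 0\<close> in \<open>auto intro: add_mono mult_left_mono\<close>)
    also have "\<dots> \<le> \<rho> ^ k * \<phi> A"
      by (rule stirring_mean_iter_le_geometric[OF \<open>\<Lambda> \<ge> 0\<close> \<rho> super]) (use A in auto)
    finally show ?thesis .
  qed
  have iter_ge: "0 \<le> (stirring_mean adj \<Lambda> ^^ k) v A" for k
    using stirring_mean_iter_related[of "\<lambda>u v. 0 \<le> v" \<Lambda> "card A" v v A k adj] A v \<open>\<Lambda> \<ge> 0\<close> by auto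
  define I where "I = (\<integral>\<zeta>. centered_product p B \<zeta> * apply_bcontfun (S t f) \<zeta> \<partial>bernoulli_product p)"
  have sums_I: "(\<lambda>k. exp (- \<Lambda> * t) * ((\<Lambda> * t) ^ k / fact k) * (stirring_mean adj \<Lambda> ^^ k) v A) sums I"
    using integral_ssep_semigroup_centered_product[OF p S A B f t] by (simp add: I_def \<Lambda>_def v_def[abs_def])
  have sums_bound: "(\<lambda>k. exp (- \<Lambda> * t) * \<phi> A * ((\<Lambda> * t * \<rho>) ^ k /\<^sub>R fact k)) sums
      (exp (- \<Lambda> * t) * \<phi> A * exp (\<Lambda> * t * \<rho>))"
    by (intro sums_mult exp_converges)
  have term_le: "exp (- \<Lambda> * t) * ((\<Lambda> * t) ^ k / fact k) * (stirring_mean adj \<Lambda> ^^ k) v A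
      \<le> exp (- \<Lambda> * t) * \<phi> A * ((\<Lambda> * t * \<rho>) ^ k /\<^sub>R fact k)" for k
  proof -
    have "exp (- \<Lambda> * t) * ((\<Lambda> * t) ^ k / fact k) * (stirring_mean adj \<Lambda> ^^ k) v A
        \<le> exp (- \<Lambda> * t) * ((\<Lambda> * t) ^ k / fact k) * (\<rho> ^ k * \<phi> A)"
      using t \<open>\<Lambda> \<ge> 0\<close> by (intro mult_left_mono iter_le) auto
    then show ?thesis by (simp add: power_mult_distrib field_simps)
  qed
  have "I \<le> exp (- \<Lambda> * t) * \<phi> A * exp (\<Lambda> * t * \<rho>)"
    by (rule sums_le[OF term_le sums_I sums_bound])
  also have "\<dots> = \<phi> A * exp (- (card A * \<kappa>) * t)"
  proof -
    have "- \<Lambda> * t + \<Lambda> * t * \<rho> = - (card A * \<kappa>) * t"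
      by (simp add: \<Lambda>_def \<rho>_def field_simps)
    then have "exp (- \<Lambda> * t) * exp (\<Lambda> * t * \<rho>) = exp (- (card A * \<kappa>) * t)"
      by (simp only: exp_add[symmetric])
    then show ?thesis by (metis mult.assoc mult.commute)
  qed
  also have "\<dots> \<le> \<phi> A * exp (- \<kappa> * t)"
  proof (intro mult_left_mono)
    have "1 \<le> real (card A)" using A by (simp add: Suc_le_eq card_gt_0_iff)
    then have "1 * (\<kappa> * t) \<le> card A * (\<kappa> * t)" using \<kappa> t by (intro mult_right_mono) auto
    then show "exp (- (card A * \<kappa>) * t) \<le> exp (- \<kappa> * t)" by simp
  qed (use w_pos[of A] w_pos[of B] in \<open>simp add: \<phi>_def\<close>)
  finally have "I \<le> \<phi> A * exp (- \<kappa> * t)" .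
  moreover have "0 \<le> I"
    using sums_le[OF _ sums_zero sums_I] iter_ge t \<open>\<Lambda> \<ge> 0\<close> by simp
  ultimately show ?thesis by (simp add: I_def \<phi>_def)
qed

end


section \<open>Stationarity and covariances of the process\<close>

text \<open>Local functions are combinations of centred products, so their integrals are determined by these
  moments; indicators of cylinder sets are local and generate the sigma-algebra.\<close>

lemma prob_space_eq_bernoulli_productI:
  assumes N: "prob_space N" "sets N = sets config_space"
    and moments: "\<And>A. finite A \<Longrightarrow> A \<noteq> {} \<Longrightarrow> (\<integral>\<zeta>. centered_product p A \<zeta> \<partial>N) = 0"
    and p: "0 \<le> p" "p \<le> 1"
  shows "N = bernoulli_product p"
proof -
  interpret N: prob_space N by fact
  interpret B: prob_space "bernoulli_product p :: 'a config measure" by (rule prob_space_bernoulli_product)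
  have space_N: "space N = UNIV" using sets_eq_imp_space_eq[OF N(2)] by simp
  have cp_meas: "centered_product p A \<in> borel_measurable N" for A
    using measurable_centered_product N(2) by (simp cong: measurable_cong_sets)
  have cp_int: "integrable N (centered_product p A)"
    "integrable (bernoulli_product p) (centered_product p A)" for A
    using abs_centered_product_le_1[OF p] cp_meas
    by (auto intro!: N.integrable_const_bound[of _ 1] B.integrable_const_bound[of _ 1] AE_I2)
  have cp_eq: "(\<integral>\<zeta>. centered_product p A \<zeta> \<partial>N) = (\<integral>\<zeta>. centered_product p A \<zeta> \<partial>bernoulli_product p)"
    if "finite A" for A
  proof (cases "A = {}")
    case True
    then show ?thesis using N.prob_space B.prob_space by simp
  next
    case False
    then show ?thesis using moments[OF that False] integral_centered_product_mult[OF p that, of "{}"] by simp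
  qed
  have eq: "(\<integral>\<zeta>. f \<zeta> \<partial>N) = (\<integral>\<zeta>. f \<zeta> \<partial>bernoulli_product p)" if f: "local_fun f" for f
  proof -
    obtain A where A: "finite A" "\<And>\<eta> \<zeta>. (\<And>x. x \<in> A \<Longrightarrow> \<eta> x = \<zeta> x) \<Longrightarrow> f \<eta> = f \<zeta>"
      using f unfolding local_fun_def by metis
    then obtain c where "f = (\<lambda>\<eta>. \<Sum>B\<in>Pow A. c B * centered_product p B \<eta>)"
      using local_fun_centered_expansion[of A f p] by blast
    then show ?thesis
      using cp_int cp_eq finite_subset[OF _ A(1)] by simp
  qed
  show ?thesis
  proof (rule measure_eqI_PiM_infinite)
    show "sets N = sets (PiM UNIV (\<lambda>_. count_space UNIV))"
      using N(2) by (simp add: config_space_def)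
    show "sets (bernoulli_product p) = sets (PiM UNIV (\<lambda>_. count_space UNIV))"
      by (simp flip: config_space_def)
    fix X :: "'a \<Rightarrow> bool set" and J :: "'a set"
    assume J: "finite J"
    define E where "E = prod_emb UNIV (\<lambda>_. count_space UNIV) J (Pi\<^sub>E J X)"
    have E_sets: "E \<in> sets config_space"
      unfolding E_def config_space_def by (intro sets_PiM_I J) auto
    have "E = {\<eta>. \<forall>x\<in>J. \<eta> x \<in> X x}"
      by (auto simp: E_def prod_emb_def PiE_iff)
    then have "local_fun (indicator E)"
      unfolding local_fun_def by (intro exI[of _ J]) (auto simp: J indicator_def)
    from eq[OF this] have "measure N E = measure (bernoulli_product p) E"
      using E_sets N(2) space_N by simp
    then show "emeasure N (prod_emb UNIV (\<lambda>_. count_space UNIV) J (Pi\<^sub>E J X))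
        = emeasure (bernoulli_product p) (prod_emb UNIV (\<lambda>_. count_space UNIV) J (Pi\<^sub>E J X))"
      unfolding E_def[symmetric] by (simp add: N.emeasure_eq_measure B.emeasure_eq_measure)
  qed (rule N.finite_measure_axioms)
qed

lemma
  assumes X: "\<And>u. u \<ge> 0 \<Longrightarrow> X u \<in> M \<rightarrow>\<^sub>M N" and s: "s \<ge> 0"
  shows subalgebra_natural_filtration: "subalgebra M (natural_filtration M N X s)"
    and measurable_natural_filtration: "X s \<in> natural_filtration M N X s \<rightarrow>\<^sub>M N"
proof -
  let ?Y = "\<lambda>\<omega>. \<lambda>u\<in>{0..s}. X u \<omega>"
  have Y: "?Y \<in> M \<rightarrow>\<^sub>M (\<Pi>\<^sub>M u\<in>{0..s}. N)"
    by (intro measurable_restrict X) auto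
  then have Y_space: "?Y \<in> space M \<rightarrow> space (\<Pi>\<^sub>M u\<in>{0..s}. N)"
    by (auto dest: measurable_space)
  show "subalgebra M (natural_filtration M N X s)"
    unfolding subalgebra_def natural_filtration_def sets_vimage_algebra2[OF Y_space]
    using measurable_sets[OF Y] by auto
  have "(\<lambda>\<omega>. ?Y \<omega> s) \<in> natural_filtration M N X s \<rightarrow>\<^sub>M N"
    unfolding natural_filtration_def
    by (rule measurable_compose[OF measurable_vimage_algebra1[OF Y_space]])
      (use s in \<open>auto intro: measurable_component_singleton\<close>)
  then show "X s \<in> natural_filtration M N X s \<rightarrow>\<^sub>M N" using s by simp
qed

text \<open>The Markov property, integrated against a function of the present state.\<close>

lemma markov_process_integral:
  assumes X: "markov_process M N X S" and s: "s \<ge> 0" and t: "t \<ge> 0"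
    and g: "g \<in> borel_measurable N" "\<And>x. \<bar>g x\<bar> \<le> b"
    and f: "apply_bcontfun f \<in> borel_measurable N" and Sf: "apply_bcontfun (S t f) \<in> borel_measurable N"
  shows "(\<integral>\<omega>. g (X s \<omega>) * apply_bcontfun f (X (s + t) \<omega>) \<partial>M)
    = (\<integral>x. g x * apply_bcontfun (S t f) x \<partial>distr M N (X s))"
proof -
  interpret prob_space M using X by (simp add: markov_process_def)
  have X_meas: "X u \<in> M \<rightarrow>\<^sub>M N" if "u \<ge> 0" for u using X that by (simp add: markov_process_def)
  note [measurable] = X_meas[OF s] X_meas[OF add_nonneg_nonneg[OF s t]] g(1) f Sf
  let ?F = "natural_filtration M N X s"
  interpret finite_measure_subalgebra M ?F
    by unfold_locales (rule subalgebra_natural_filtration[OF X_meas s])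
  let ?f = "\<lambda>\<omega>. apply_bcontfun f (X (s + t) \<omega>)"
  have gX: "(\<lambda>\<omega>. g (X s \<omega>)) \<in> borel_measurable ?F"
    by (rule measurable_compose[OF measurable_natural_filtration[OF X_meas s] g(1)])
  have int: "integrable M (\<lambda>\<omega>. g (X s \<omega>) * ?f \<omega>)"
  proof (rule integrable_const_bound[of _ "b * norm f"])
    show "AE \<omega> in M. norm (g (X s \<omega>) * ?f \<omega>) \<le> b * norm f"
      using mult_mono'[OF g(2) norm_bounded[of f] abs_ge_zero norm_ge_zero]
      by (intro AE_I2) (auto simp: abs_mult)
  qed measurable
  have "(\<integral>\<omega>. g (X s \<omega>) * ?f \<omega> \<partial>M) = (\<integral>\<omega>. g (X s \<omega>) * real_cond_exp M ?F ?f \<omega> \<partial>M)"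
    by (rule real_cond_exp_intg(2)[OF int gX, symmetric]) measurable
  also have "\<dots> = (\<integral>\<omega>. g (X s \<omega>) * apply_bcontfun (S t f) (X s \<omega>) \<partial>M)"
  proof (rule integral_cong_AE)
    have "AE \<omega> in M. real_cond_exp M ?F ?f \<omega> = apply_bcontfun (S t f) (X s \<omega>)"
      using X s t by (simp add: markov_process_def)
    then show "AE \<omega> in M. g (X s \<omega>) * real_cond_exp M ?F ?f \<omega>
        = g (X s \<omega>) * apply_bcontfun (S t f) (X s \<omega>)" by eventually_elim simp
  qed measurable
  also have "\<dots> = (\<integral>x. g x * apply_bcontfun (S t f) x \<partial>distr M N (X s))"
    by (subst integral_distr) measurable
  finally show ?thesis .
qed

lemma local_fun_bcontfun:
  fixes adj :: "'v \<Rightarrow> 'v \<Rightarrow> bool" and f :: "'v config \<Rightarrow> real"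
  assumes "ssep_semigroup adj S" "local_fun f"
  obtains g where "apply_bcontfun g = f"
proof -
  have "\<exists>g. apply_bcontfun g = f" using assms by (auto simp: ssep_semigroup_def)
  then show thesis using that by blast
qed

context regular_graph
begin

lemma ssep_stationary:
  assumes p: "0 \<le> p" "p \<le> 1" and S: "ssep_semigroup adj S"
    and \<eta>: "markov_process M config_space \<eta> S"
    and init: "distr M config_space (\<eta> 0) = bernoulli_product p" and t: "t \<ge> 0"
  shows "distr M config_space (\<eta> t) = bernoulli_product p"
proof (rule prob_space_eq_bernoulli_productI[OF _ _ _ p])
  interpret prob_space M using \<eta> by (simp add: markov_process_def)
  have meas: "\<eta> t \<in> M \<rightarrow>\<^sub>M config_space" using \<eta> t by (simp add: markov_process_def)
  show "prob_space (distr M config_space (\<eta> t))" by (rule prob_space_distr[OF meas])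
  fix A :: "'v set" assume A: "finite A" "A \<noteq> {}"
  obtain f where f: "apply_bcontfun f = centered_product p A"
    using local_fun_bcontfun[OF S local_centered_product[OF A(1)]] .
  have "(\<integral>\<zeta>. centered_product p A \<zeta> \<partial>distr M config_space (\<eta> t))
      = (\<integral>\<omega>. 1 * apply_bcontfun f (\<eta> (0 + t) \<omega>) \<partial>M)"
    using meas by (subst integral_distr) (auto simp: f)
  also have "\<dots> = (\<integral>\<zeta>. 1 * apply_bcontfun (S t f) \<zeta> \<partial>bernoulli_product p)"
    unfolding init[symmetric]
    by (rule markov_process_integral[OF \<eta> _ t, where b = 1])
      (use measurable_ssep_semigroup_centered_product[OF p S A f t] in \<open>auto simp: f\<close>)
  also have "\<dots> = 0"
    using integral_ssep_semigroup_centered_product_eq_0[OF p S A f t] by simp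
  finally show "(\<integral>\<zeta>. centered_product p A \<zeta> \<partial>distr M config_space (\<eta> t)) = 0" .
qed simp

lemma ssep_covariance:
  assumes p: "0 \<le> p" "p \<le> 1" and S: "ssep_semigroup adj S"
    and \<eta>: "markov_process M config_space \<eta> S"
    and init: "distr M config_space (\<eta> 0) = bernoulli_product p" and s: "s \<ge> 0" and t: "t \<ge> 0"
    and A: "finite A" "A \<noteq> {}" and B: "finite B" and f: "apply_bcontfun f = centered_product p A"
  shows "(\<integral>\<omega>. centered_product p B (\<eta> s \<omega>) * centered_product p A (\<eta> (s + t) \<omega>) \<partial>M)
    = (\<integral>\<zeta>. centered_product p B \<zeta> * apply_bcontfun (S t f) \<zeta> \<partial>bernoulli_product p)"
  using markov_process_integral[OF \<eta> s t measurable_centered_product abs_centered_product_le_1[OF p], of f B]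
    measurable_ssep_semigroup_centered_product[OF p S A f t] ssep_stationary[OF p S \<eta> init s]
  by (simp add: f)

end


section \<open>Variance of time integrals of stationary processes\<close>

lemma integrable_exp_neg_abs:
  assumes "\<kappa> > (0 :: real)"
  shows "integrable lborel (\<lambda>u. exp (- \<kappa> * \<bar>u\<bar>))"
proof -
  define g where "g u = indicator {0<..} u *\<^sub>R exp (- (u * \<kappa>))" for u :: real
  have g: "integrable lborel g"
    using integrable_I0i_exp_mscale[OF assms] by (simp add: set_integrable_def g_def[abs_def])
  then have "integrable lborel (\<lambda>u. g (0 + (- 1) * u))"
    by (rule lborel_integrable_real_affine) simp
  with g have sum_g: "integrable lborel (\<lambda>u. g u + g (- u))" by simp
  show ?thesis
  proof (rule Bochner_Integration.integrable_bound[OF sum_g])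
    have "AE u in lborel. u \<noteq> (0 :: real)" by (rule AE_lborel_singleton)
    then show "AE u in lborel. norm (exp (- \<kappa> * \<bar>u\<bar>)) \<le> norm (g u + g (- u))"
      by eventually_elim (auto simp: g_def abs_if mult.commute split: split_indicator)
  qed simp
qed

text \<open>The length of the intersection of an interval with its translate.\<close>

lemma lborel_integral_overlap:
  assumes t: "t \<ge> 0"
  shows "(\<integral>s. indicator {0..t} s * indicator {0..t} (s + u) \<partial>lborel) = max 0 (t - \<bar>u :: real\<bar>)"
proof -
  have "(\<integral>s. indicator {0..t} s * indicator {0..t} (s + u) \<partial>lborel)
      = (\<integral>s. indicator {max 0 (- u)..min t (t - u)} s \<partial>lborel :: real)"
    by (intro Bochner_Integration.integral_cong) (auto split: split_indicator)
  also have "\<dots> = measure lborel {max 0 (- u)..min t (t - u)}"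
    by simp
  also have "\<dots> = max 0 (t - \<bar>u\<bar>)"
    using t by (auto simp: max_def min_def abs_if)
  finally show ?thesis .
qed

text \<open>Substituting \<open>u = r - s\<close> and integrating over \<open>s\<close> first.\<close>

lemma double_integral_stationary:
  fixes c :: "real \<Rightarrow> real"
  assumes [measurable]: "c \<in> borel_measurable borel" and c: "\<And>u. \<bar>c u\<bar> \<le> b" and t: "t \<ge> 0"
  shows "(\<integral>s. indicator {0..t} s * (\<integral>r. indicator {0..t} r * c (r - s) \<partial>lborel) \<partial>lborel)
    = (\<integral>u. max 0 (t - \<bar>u\<bar>) * c u \<partial>lborel)"
proof -
  define f where "f s u = indicator {0..t} s * (indicator {0..t} (s + u) * c u)" for s u :: real
  have "(\<integral>r. indicator {0..t} r * c (r - s) \<partial>lborel)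
      = (\<integral>u. indicator {0..t} (s + u) * c u \<partial>lborel)" for s
    using lborel_integral_real_affine[of 1 "\<lambda>r. indicator {0..t} r * c (r - s)" s] by simp
  then have "(\<integral>s. indicator {0..t} s * (\<integral>r. indicator {0..t} r * c (r - s) \<partial>lborel) \<partial>lborel)
      = (\<integral>s. \<integral>u. f s u \<partial>lborel \<partial>lborel)"
    by (simp add: f_def)
  also have "\<dots> = (\<integral>u. \<integral>s. f s u \<partial>lborel \<partial>lborel)"
  proof (rule lborel_pair.Fubini_integral[symmetric])
    show "integrable (lborel \<Otimes>\<^sub>M lborel) (\<lambda>(s, u). f s u)"
    proof (rule integrableI_bounded_set[where A = "{0..t} \<times> {- t..t}" and B = b])
      show "emeasure (lborel \<Otimes>\<^sub>M lborel) ({0..t} \<times> {- t..t}) < \<infinity>"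
        using t by (subst lborel.emeasure_pair_measure_Times) (auto simp: ennreal_mult_less_top)
      show "AE x in lborel \<Otimes>\<^sub>M lborel. x \<in> {0..t} \<times> {- t..t} \<longrightarrow> norm (case x of (s, u) \<Rightarrow> f s u) \<le> b"
        using c order_trans[OF abs_ge_zero c]
        by (intro AE_I2) (auto simp: f_def split: split_indicator)
    qed (auto simp: f_def indicator_def intro!: AE_I2 split: if_splits)
  qed
  also have "\<dots> = (\<integral>u. max 0 (t - \<bar>u\<bar>) * c u \<partial>lborel)"
  proof (intro Bochner_Integration.integral_cong refl)
    fix u
    have "(\<integral>s. f s u \<partial>lborel) = (\<integral>s. (indicator {0..t} s * indicator {0..t} (s + u)) * c u \<partial>lborel)"
      by (simp add: f_def mult.assoc)
    also have "\<dots> = max 0 (t - \<bar>u\<bar>) * c u"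
      using lborel_integral_overlap[OF t, of u] by simp
    finally show "(\<integral>s. f s u \<partial>lborel) = max 0 (t - \<bar>u\<bar>) * c u" .
  qed
  finally show ?thesis .
qed

text \<open>The kernels \<open>max 0 (1 - \<bar>u\<bar> / t)\<close> increase to \<open>1\<close>, so this is dominated convergence.\<close>

lemma fejer_mean_tendsto:
  fixes c :: "real \<Rightarrow> real"
  assumes c: "integrable lborel c"
  shows "((\<lambda>t. 1 / t * (\<integral>u. max 0 (t - \<bar>u\<bar>) * c u \<partial>lborel)) \<longlongrightarrow> (\<integral>u. c u \<partial>lborel)) at_top"
proof -
  have [measurable]: "c \<in> borel_measurable borel" using c by auto
  have "((\<lambda>t. \<integral>u. 1 / t * (max 0 (t - \<bar>u\<bar>) * c u) \<partial>lborel) \<longlongrightarrow> (\<integral>u. c u \<partial>lborel)) at_top"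
  proof (rule integral_dominated_convergence_at_top[where w = "\<lambda>u. \<bar>c u\<bar>"])
    show "integrable lborel (\<lambda>u. \<bar>c u\<bar>)" using c by simp
    show "\<forall>\<^sub>F t in at_top. AE u in lborel. norm (1 / t * (max 0 (t - \<bar>u\<bar>) * c u)) \<le> \<bar>c u\<bar>"
      using eventually_gt_at_top[of 0]
    proof (eventually_elim, intro AE_I2)
      fix t u :: real assume t: "0 < t"
      have "\<bar>1 / t * max 0 (t - \<bar>u\<bar>)\<bar> \<le> 1" using t by (auto simp: abs_mult max_def field_simps)
      then have "\<bar>1 / t * max 0 (t - \<bar>u\<bar>)\<bar> * \<bar>c u\<bar> \<le> 1 * \<bar>c u\<bar>" by (intro mult_right_mono) auto
      then show "norm (1 / t * (max 0 (t - \<bar>u\<bar>) * c u)) \<le> \<bar>c u\<bar>" by (simp add: abs_mult mult_ac)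
    qed
    have "((\<lambda>t. 1 / t * (max 0 (t - \<bar>u\<bar>) * c u)) \<longlongrightarrow> c u) at_top" for u
    proof (rule Lim_transform_eventually)
      have "((\<lambda>t. \<bar>u\<bar> / t) \<longlongrightarrow> 0) at_top"
        by (intro real_tendsto_divide_at_top[OF tendsto_const] filterlim_ident)
      then have "((\<lambda>t. (1 - \<bar>u\<bar> / t) * c u) \<longlongrightarrow> (1 - 0) * c u) at_top"
        by (intro tendsto_intros)
      then show "((\<lambda>t. (1 - \<bar>u\<bar> / t) * c u) \<longlongrightarrow> c u) at_top" by simp
      show "\<forall>\<^sub>F t in at_top. (1 - \<bar>u\<bar> / t) * c u = 1 / t * (max 0 (t - \<bar>u\<bar>) * c u)"
        using eventually_gt_at_top[of "\<bar>u\<bar>"] by eventually_elim (simp add: max_def field_simps)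
    qed
    then show "AE u in lborel. ((\<lambda>t. 1 / t * (max 0 (t - \<bar>u\<bar>) * c u)) \<longlongrightarrow> c u) at_top" by simp
  qed simp_all
  then show ?thesis by simp
qed

text \<open>Fubini's theorem turns the second moment of the time integral into a double integral of the
  covariance, which depends only on the distance of the two times.\<close>

lemma (in prob_space) variance_additive_functional_tendsto:
  fixes X :: "real \<Rightarrow> 'a \<Rightarrow> real"
  assumes meas: "(\<lambda>(s, \<omega>). indicator {0..} s * X s \<omega>) \<in> borel_measurable (lborel \<Otimes>\<^sub>M M)"
    and bounded: "\<And>s \<omega>. \<bar>X s \<omega>\<bar> \<le> b"
    and mean: "\<And>s. s \<ge> 0 \<Longrightarrow> expectation (X s) = 0"
    and cov: "\<And>s u. s \<ge> 0 \<Longrightarrow> u \<ge> 0 \<Longrightarrow> expectation (\<lambda>\<omega>. X s \<omega> * X (s + u) \<omega>) = C u"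
    and decay: "\<And>u. u \<ge> 0 \<Longrightarrow> \<bar>C u\<bar> \<le> K * exp (- \<kappa> * u)" and \<kappa>: "\<kappa> > 0"
  shows "((\<lambda>t. 1 / t * variance (\<lambda>\<omega>. LINT s:{0..t}|lborel. X s \<omega>)) \<longlongrightarrow> (\<integral>u. C \<bar>u\<bar> \<partial>lborel)) at_top"
proof -
  define Y where "Y s \<omega> = indicator {0..} s * X s \<omega>" for s \<omega>
  have Y_meas: "(\<lambda>(s, \<omega>). Y s \<omega>) \<in> borel_measurable (lborel \<Otimes>\<^sub>M M)"
    using meas by (simp add: Y_def)
  moreover have "sets (borel \<Otimes>\<^sub>M M) = sets (lborel \<Otimes>\<^sub>M M)"
    by (intro sets_pair_measure_cong) simp_all
  ultimately have [measurable]: "case_prod Y \<in> borel_measurable (borel \<Otimes>\<^sub>M M)"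
    by (subst measurable_cong_sets[OF _ refl])
  have Y_bound: "\<bar>Y s \<omega>\<bar> \<le> b" for s \<omega>
    using bounded[of s \<omega>] by (auto simp: Y_def split: split_indicator)
  have b: "b \<ge> 0" using bounded[of 0 undefined] by (rule order_trans[OF abs_ge_zero])
  define \<xi> where "\<xi> t \<omega> = (\<integral>s. indicator {0..t} s * Y s \<omega> \<partial>lborel)" for t \<omega>
  have \<xi>_eq: "(LINT s:{0..t}|lborel. X s \<omega>) = \<xi> t \<omega>" for t \<omega>
    unfolding \<xi>_def set_lebesgue_integral_def
    by (intro Bochner_Integration.integral_cong) (auto simp: Y_def split: split_indicator)
  have \<xi>_meas [measurable]: "\<xi> t \<in> borel_measurable M" for t
    unfolding \<xi>_def by measurable
  interpret P: pair_sigma_finite lborel M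
    by (intro pair_sigma_finite.intro sigma_finite_measure_axioms lborel.sigma_finite_measure_axioms)
  have \<xi>_bound: "\<bar>\<xi> t \<omega>\<bar> \<le> b * t" if "t \<ge> 0" "\<omega> \<in> space M" for t \<omega>
  proof -
    have [measurable]: "(\<lambda>s. Y s \<omega>) \<in> borel_measurable borel"
      using that by measurable
    have "integrable lborel (\<lambda>s. indicator {0..t} s * Y s \<omega>)"
      by (rule integrableI_bounded_set[where A = "{0..t}" and B = b])
        (use Y_bound that in \<open>auto simp: abs_mult split: split_indicator intro!: AE_I2\<close>)
    moreover have "integrable lborel (\<lambda>s. b * indicator {0..t} s :: real)"
      using that by simp
    ultimately have "norm (\<xi> t \<omega>) \<le> (\<integral>s. b * indicator {0..t} s \<partial>lborel)"
      unfolding \<xi>_def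
      by (rule Bochner_Integration.integral_norm_bound_integral)
        (use Y_bound b in \<open>auto split: split_indicator\<close>)
    also have "\<dots> = b * t" using that by simp
    finally show ?thesis by simp
  qed
  have swap: "expectation (\<lambda>\<omega>. Z \<omega> * \<xi> t \<omega>)
      = (\<integral>s. indicator {0..t} s * expectation (\<lambda>\<omega>. Z \<omega> * Y s \<omega>) \<partial>lborel)"
    if [measurable]: "Z \<in> borel_measurable M" and Z: "\<And>\<omega>. \<omega> \<in> space M \<Longrightarrow> \<bar>Z \<omega>\<bar> \<le> b'" and t: "t \<ge> 0"
    for Z t b'
  proof -
    define f where "f s \<omega> = indicator {0..t} s * (Z \<omega> * Y s \<omega>)" for s \<omega>
    have "integrable (lborel \<Otimes>\<^sub>M M) (\<lambda>(s, \<omega>). f s \<omega>)"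
    proof (rule integrableI_bounded_set[where A = "{0..t} \<times> space M" and B = "b' * b"])
      show "emeasure (lborel \<Otimes>\<^sub>M M) ({0..t} \<times> space M) < \<infinity>"
        using t by (subst emeasure_pair_measure_Times) (auto simp: emeasure_space_1)
      show "AE x in lborel \<Otimes>\<^sub>M M. x \<in> {0..t} \<times> space M \<longrightarrow> norm (case x of (s, \<omega>) \<Rightarrow> f s \<omega>) \<le> b' * b"
      proof (intro AE_I2 impI)
        fix x assume "x \<in> {0..t} \<times> space M"
        then show "norm (case x of (s, \<omega>) \<Rightarrow> f s \<omega>) \<le> b' * b"
          using mult_mono'[OF Z Y_bound abs_ge_zero abs_ge_zero] by (auto simp: f_def abs_mult)
      qed
    qed (auto simp: f_def space_pair_measure indicator_def intro!: AE_I2 split: if_splits)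
    from P.Fubini_integral[OF this]
    have "expectation (\<lambda>\<omega>. \<integral>s. f s \<omega> \<partial>lborel) = (\<integral>s. expectation (f s) \<partial>lborel)" .
    moreover have "(\<integral>s. f s \<omega> \<partial>lborel) = Z \<omega> * \<xi> t \<omega>" for \<omega>
      unfolding f_def \<xi>_def by (simp add: mult.left_commute)
    ultimately show ?thesis by (simp add: f_def[abs_def])
  qed
  define c where "c u = expectation (\<lambda>\<omega>. Y 0 \<omega> * Y \<bar>u\<bar> \<omega>)" for u
  have c_meas [measurable]: "c \<in> borel_measurable borel" unfolding c_def by measurable
  have c_eq: "c u = C \<bar>u\<bar>" for u using cov[of 0 "\<bar>u\<bar>"] by (simp add: c_def Y_def)
  have c_decay: "\<bar>c u\<bar> \<le> K * exp (- \<kappa> * \<bar>u\<bar>)" for u using decay[of "\<bar>u\<bar>"] by (simp add: c_eq)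
  have K: "K \<ge> 0" using decay[of 0] by simp
  have c_bound: "\<bar>c u\<bar> \<le> K" for u
  proof -
    have "K * exp (- \<kappa> * \<bar>u\<bar>) \<le> K * 1" using \<kappa> K by (intro mult_left_mono) auto
    then show ?thesis using c_decay[of u] by linarith
  qed
  have c_int: "integrable lborel c"
    by (rule Bochner_Integration.integrable_bound[OF integrable_mult_right[OF integrable_exp_neg_abs[OF \<kappa>], of K]])
      (use c_decay K in \<open>auto simp: abs_mult\<close>)
  have cov_Y: "expectation (\<lambda>\<omega>. Y s \<omega> * Y r \<omega>) = c (r - s)" if "s \<ge> 0" "r \<ge> 0" for s r
  proof (cases "s \<le> r")
    case True
    then show ?thesis using cov[of s "r - s"] that by (simp add: c_eq Y_def)
  next
    case False
    then show ?thesis using cov[of r "s - r"] that by (simp add: c_eq Y_def mult.commute)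
  qed
  have var: "variance (\<xi> t) = (\<integral>u. max 0 (t - \<bar>u\<bar>) * c u \<partial>lborel)" if t: "t \<ge> 0" for t
  proof -
    have "expectation (\<lambda>\<omega>. 1 * \<xi> t \<omega>) = (\<integral>s. indicator {0..t} s * expectation (\<lambda>\<omega>. 1 * Y s \<omega>) \<partial>lborel)"
      by (rule swap[OF borel_measurable_const order_refl t])
    also have "\<dots> = (\<integral>s. 0 \<partial>(lborel :: real measure))"
      by (intro Bochner_Integration.integral_cong) (auto simp: Y_def mean split: split_indicator)
    finally have "variance (\<xi> t) = expectation (\<lambda>\<omega>. \<xi> t \<omega> * \<xi> t \<omega>)"
      by (simp add: power2_eq_square)
    also have "\<dots> = (\<integral>s. indicator {0..t} s * expectation (\<lambda>\<omega>. \<xi> t \<omega> * Y s \<omega>) \<partial>lborel)"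
      by (rule swap[OF \<xi>_meas \<xi>_bound[OF t] t])
    also have "\<dots> = (\<integral>s. indicator {0..t} s * (\<integral>r. indicator {0..t} r * c (r - s) \<partial>lborel) \<partial>lborel)"
    proof (intro Bochner_Integration.integral_cong refl)
      fix s
      have "expectation (\<lambda>\<omega>. \<xi> t \<omega> * Y s \<omega>) = (\<integral>r. indicator {0..t} r * c (r - s) \<partial>lborel)"
        if "s \<ge> 0"
      proof -
        have "expectation (\<lambda>\<omega>. Y s \<omega> * \<xi> t \<omega>)
            = (\<integral>r. indicator {0..t} r * expectation (\<lambda>\<omega>. Y s \<omega> * Y r \<omega>) \<partial>lborel)"
          by (rule swap[OF _ Y_bound t]) measurable
        also have "\<dots> = (\<integral>r. indicator {0..t} r * c (r - s) \<partial>lborel)"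
          using cov_Y that by (intro Bochner_Integration.integral_cong) (auto split: split_indicator)
        finally show ?thesis by (simp add: mult.commute)
      qed
      then show "indicator {0..t} s * expectation (\<lambda>\<omega>. \<xi> t \<omega> * Y s \<omega>)
          = indicator {0..t} s * (\<integral>r. indicator {0..t} r * c (r - s) \<partial>lborel)"
        by (auto split: split_indicator)
    qed
    also have "\<dots> = (\<integral>u. max 0 (t - \<bar>u\<bar>) * c u \<partial>lborel)"
      by (rule double_integral_stationary[OF c_meas c_bound t])
    finally show ?thesis .
  qed
  have "((\<lambda>t. 1 / t * (\<integral>u. max 0 (t - \<bar>u\<bar>) * c u \<partial>lborel)) \<longlongrightarrow> (\<integral>u. c u \<partial>lborel)) at_top"
    by (rule fejer_mean_tendsto[OF c_int])
  then have "((\<lambda>t. 1 / t * variance (\<xi> t)) \<longlongrightarrow> (\<integral>u. c u \<partial>lborel)) at_top"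
    by (rule Lim_transform_eventually)
      (use eventually_ge_at_top[of 0] in \<open>eventually_elim, simp add: var\<close>)
  then show ?thesis by (simp add: \<xi>_eq c_eq)
qed

text \<open>Each time is approximated from the right by a grid point that takes countably many values. The
  indicator discards negative times, at which nothing is assumed.\<close>

lemma right_continuous_jointly_measurable:
  fixes X :: "real \<Rightarrow> 'a \<Rightarrow> real"
  assumes meas: "\<And>s. s \<ge> 0 \<Longrightarrow> X s \<in> borel_measurable M"
    and right: "\<And>s \<omega>. s \<ge> 0 \<Longrightarrow> \<omega> \<in> space M \<Longrightarrow> ((\<lambda>u. X u \<omega>) \<longlongrightarrow> X s \<omega>) (at_right s)"
  shows "(\<lambda>(s, \<omega>). indicator {0..} s * X s \<omega>) \<in> borel_measurable (lborel \<Otimes>\<^sub>M M)"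
proof -
  \<comment> \<open>The first point of the grid with mesh \<open>1 / Suc n\<close> that lies strictly to the right of \<open>s\<close>.\<close>
  define q where "q n s = (real_of_int \<lfloor>real (Suc n) * s\<rfloor> + 1) / real (Suc n)" for n s
  have q_gt: "s < q n s" for n s
  proof -
    have "s * real (Suc n) < real_of_int \<lfloor>real (Suc n) * s\<rfloor> + 1"
      using real_of_int_floor_add_one_gt[of "real (Suc n) * s"] by (simp only: mult.commute)
    then show ?thesis unfolding q_def by (subst pos_less_divide_eq) auto
  qed
  then have q_ne: "q n s \<noteq> s" for n s using less_imp_neq by metis
  have q_le: "q n s \<le> s + 1 / real (Suc n)" for n s
  proof -
    have "real_of_int \<lfloor>real (Suc n) * s\<rfloor> + 1 \<le> real (Suc n) * s + 1" by simp
    then have "q n s \<le> (real (Suc n) * s + 1) / real (Suc n)"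
      unfolding q_def by (intro divide_right_mono) auto
    then show ?thesis by (simp add: add_divide_distrib del: of_nat_Suc)
  qed
  have q_lim: "filterlim (\<lambda>n. q n s) (at_right s) sequentially" for s
    unfolding filterlim_at
  proof (intro conjI always_eventually allI)
    have "(\<lambda>n. s + 1 / real (Suc n)) \<longlonglongrightarrow> s + 0"
      by (intro tendsto_add tendsto_const LIMSEQ_Suc lim_1_over_n)
    then show "(\<lambda>n. q n s) \<longlonglongrightarrow> s"
      using q_le q_gt by (intro tendsto_sandwich[of "\<lambda>_. s" "\<lambda>n. q n s" sequentially "\<lambda>n. s + 1 / real (Suc n)"])
        (auto intro!: always_eventually intro: less_imp_le)
  qed (use q_gt q_ne in auto)
  define Z where "Z n i = (if i \<ge> 0 then X ((real_of_int i + 1) / real (Suc n)) else (\<lambda>_. 0))" for n i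
  have Z_meas: "Z n i \<in> borel_measurable M" for n i
    by (auto simp: Z_def intro!: meas)
  show ?thesis
  proof (rule borel_measurable_LIMSEQ_real)
    fix n
    have "(\<lambda>x. Z n \<lfloor>real (Suc n) * fst x\<rfloor> (snd x)) \<in> borel_measurable (lborel \<Otimes>\<^sub>M M)"
      by (rule measurable_compose_countable[where f = "\<lambda>i x. Z n i (snd x)"])
        (use Z_meas in measurable)
    then show "(\<lambda>x. indicator {0..} (fst x) * Z n \<lfloor>real (Suc n) * fst x\<rfloor> (snd x))
        \<in> borel_measurable (lborel \<Otimes>\<^sub>M M)"
      by measurable
  next
    fix x :: "real \<times> 'a" assume "x \<in> space (lborel \<Otimes>\<^sub>M M)"
    then obtain s \<omega> where x: "x = (s, \<omega>)" "\<omega> \<in> space M" by (auto simp: space_pair_measure)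
    have "(\<lambda>n. indicator {0..} s * Z n \<lfloor>real (Suc n) * s\<rfloor> \<omega>) \<longlonglongrightarrow> indicator {0..} s * X s \<omega>"
    proof (cases "s \<ge> 0")
      case True
      then have "Z n \<lfloor>real (Suc n) * s\<rfloor> \<omega> = X (q n s) \<omega>" for n
        by (simp add: Z_def q_def)
      then show ?thesis
        using filterlim_compose[OF right[OF True x(2)] q_lim] True by simp
    qed simp
    then show "(\<lambda>n. indicator {0..} (fst x) * Z n \<lfloor>real (Suc n) * fst x\<rfloor> (snd x))
        \<longlonglongrightarrow> (case x of (s, \<omega>) \<Rightarrow> indicator {0..} s * X s \<omega>)"
      by (simp add: x)
  qed
qed


section \<open>Diffusive variance of local additive functionals\<close>

theorem lemma1p1:
  fixes d :: nat and p :: real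
    and adj :: "'v \<Rightarrow> 'v \<Rightarrow> bool"
    and M :: "'w measure" and \<eta> :: "real \<Rightarrow> 'w \<Rightarrow> 'v config"
    and F :: "'v config \<Rightarrow> real"
  assumes "d \<ge> 2" and "0 < p" and "p < 1"
    and "regular_tree d adj"
    and "ssep adj M \<eta>"
    and "distr M config_space (\<eta> 0) = bernoulli_product p"
    and "local_fun F"
    and "(\<integral>\<zeta>. F \<zeta> \<partial>(bernoulli_product p)) = 0"
  shows "\<exists>\<sigma>::real.
    ((\<lambda>t. 1 / t * prob_space.variance M (additive_functional \<eta> F t)) \<longlongrightarrow> \<sigma>\<^sup>2) at_top"
proof -
  note init = assms(6)
  have p: "0 \<le> p" "p \<le> 1" using assms(2,3) by auto
  interpret regular_graph adj d
    using assms(4) by unfold_locales (auto simp: regular_tree_def graph_tree_def simple_graph_def)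
  obtain S where S: "ssep_semigroup adj S" and \<eta>: "markov_process M config_space \<eta> S"
    using assms(5) by (auto simp: ssep_def)
  interpret prob_space M using \<eta> by (simp add: markov_process_def)
  interpret \<nu>: prob_space "bernoulli_product p :: 'v config measure" by (rule prob_space_bernoulli_product)
  have \<eta>_meas: "\<eta> s \<in> M \<rightarrow>\<^sub>M config_space" if "s \<ge> 0" for s
    using \<eta> that by (simp add: markov_process_def)
  have cp_meas: "(\<lambda>\<omega>. centered_product p A (\<eta> s \<omega>)) \<in> borel_measurable M" if "s \<ge> 0" for s A
    by (rule measurable_compose[OF \<eta>_meas[OF that] measurable_centered_product])
  have cp_int: "integrable M (\<lambda>\<omega>. centered_product p A (\<eta> s \<omega>))" if "s \<ge> 0" for s A
    by (rule integrable_const_bound[of _ 1])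
      (use cp_meas[OF that] abs_centered_product_le_1[OF p] in auto)
  have cp_mean: "expectation (\<lambda>\<omega>. centered_product p A (\<eta> s \<omega>)) = 0"
    if "finite A" "A \<noteq> {}" "s \<ge> 0" for s A
  proof -
    have "expectation (\<lambda>\<omega>. centered_product p A (\<eta> s \<omega>))
        = (\<integral>\<zeta>. centered_product p A \<zeta> \<partial>distr M config_space (\<eta> s))"
      using \<eta>_meas[OF that(3)] by (subst integral_distr) auto
    then show ?thesis
      using ssep_stationary[OF p S \<eta> init that(3)] integral_centered_product_mult[OF p that(1), of "{}"] that
      by simp
  qed

  obtain V where V: "finite V" "\<And>\<eta> \<zeta>. (\<And>x. x \<in> V \<Longrightarrow> \<eta> x = \<zeta> x) \<Longrightarrow> F \<eta> = F \<zeta>"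
    using assms(7) unfolding local_fun_def by metis
  then obtain a where a: "F = (\<lambda>\<eta>. \<Sum>B\<in>Pow V. a B * centered_product p B \<eta>)"
    using local_fun_centered_expansion[of V F p] by blast
  \<comment> \<open>The empty set is removed because its coefficient is the mean of \<open>F\<close>.\<close>
  define \<B> where "\<B> = Pow V - {{}}"
  have \<B>: "finite \<B>" "\<And>B. B \<in> \<B> \<Longrightarrow> finite B \<and> B \<noteq> {}"
    using V(1) finite_subset by (auto simp: \<B>_def)
  have F_split: "F \<zeta> = a {} + (\<Sum>B\<in>\<B>. a B * centered_product p B \<zeta>)" for \<zeta>
    unfolding a \<B>_def using V(1) by (subst sum.remove[of _ "{}"]) auto
  have "(\<integral>\<zeta>. F \<zeta> \<partial>bernoulli_product p) = a {}"
  proof -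
    have "integrable (bernoulli_product p) (centered_product p B :: 'v config \<Rightarrow> real)" for B
      using abs_centered_product_le_1[OF p] by (auto intro!: \<nu>.integrable_const_bound[of _ 1] AE_I2)
    moreover have "(\<integral>\<zeta>. centered_product p B \<zeta> \<partial>bernoulli_product p) = 0" if "B \<in> \<B>" for B
      using integral_centered_product_mult[OF p, of B "{}"] \<B>(2)[OF that] by simp
    ultimately show ?thesis using \<nu>.prob_space by (simp add: F_split)
  qed
  then have F_eq: "F \<zeta> = (\<Sum>B\<in>\<B>. a B * centered_product p B \<zeta>)" for \<zeta>
    using assms(8) F_split by simp

  obtain w :: "'v \<Rightarrow> real" and \<kappa> where \<kappa>: "\<kappa> > 0"
    and w: "\<And>x. w x > 0" "\<And>x. (\<Sum>y | adj x y. w y) \<le> (real d + 1 - \<kappa>) * w x"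
    by (rule regular_tree_superharmonic[OF assms(1,4)]) (rule that)
  have "\<exists>f. apply_bcontfun f = centered_product p B" if "B \<in> \<B>" for B
    using local_fun_bcontfun[OF S local_centered_product] \<B>(2)[OF that] by metis
  then obtain D where D: "\<And>B. B \<in> \<B> \<Longrightarrow> apply_bcontfun (D B) = centered_product p B" by metis
  define I where "I A B t = (\<integral>\<zeta>. centered_product p A \<zeta> * apply_bcontfun (S t (D B)) \<zeta> \<partial>bernoulli_product p)"
    for A B t
  define C where "C t = (\<Sum>A\<in>\<B>. \<Sum>B\<in>\<B>. a A * a B * I A B t)" for t
  define K where "K = (\<Sum>A\<in>\<B>. \<Sum>B\<in>\<B>. \<bar>a A * a B\<bar> * (prod w B / prod w A))"
  have cov: "expectation (\<lambda>\<omega>. F (\<eta> s \<omega>) * F (\<eta> (s + t) \<omega>)) = C t" if s: "s \<ge> 0" and t: "t \<ge> 0" for s t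
  proof -
    have int: "integrable M (\<lambda>\<omega>. centered_product p A (\<eta> s \<omega>) * centered_product p B (\<eta> (s + t) \<omega>))" for A B
    proof (rule integrable_const_bound[of _ 1])
      show "AE \<omega> in M. norm (centered_product p A (\<eta> s \<omega>) * centered_product p B (\<eta> (s + t) \<omega>)) \<le> 1"
        using abs_centered_product_le_1[OF p] by (intro AE_I2) (auto simp: abs_mult intro!: mult_le_one)
    qed (intro borel_measurable_times cp_meas add_nonneg_nonneg s t)
    have "F (\<eta> s \<omega>) * F (\<eta> (s + t) \<omega>) = (\<Sum>A\<in>\<B>. \<Sum>B\<in>\<B>. a A * a B *
        (centered_product p A (\<eta> s \<omega>) * centered_product p B (\<eta> (s + t) \<omega>)))" for \<omega>
      unfolding F_eq sum_product by (intro sum.cong refl) simp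
    then have "expectation (\<lambda>\<omega>. F (\<eta> s \<omega>) * F (\<eta> (s + t) \<omega>)) = (\<Sum>A\<in>\<B>. \<Sum>B\<in>\<B>. a A * a B *
        expectation (\<lambda>\<omega>. centered_product p A (\<eta> s \<omega>) * centered_product p B (\<eta> (s + t) \<omega>)))"
      using int by simp
    also have "\<dots> = C t"
      unfolding C_def I_def using ssep_covariance[OF p S \<eta> init s t] \<B>(2) D
      by (intro sum.cong refl) auto
    finally show ?thesis .
  qed
  have decay: "\<bar>C t\<bar> \<le> K * exp (- \<kappa> * t)" if t: "t \<ge> 0" for t
  proof -
    have "\<bar>C t\<bar> \<le> (\<Sum>A\<in>\<B>. \<Sum>B\<in>\<B>. \<bar>a A * a B * I A B t\<bar>)"
      unfolding C_def by (intro order_trans[OF sum_abs] sum_mono order_refl)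
    also have "\<dots> \<le> (\<Sum>A\<in>\<B>. \<Sum>B\<in>\<B>. \<bar>a A * a B\<bar> * (prod w B / prod w A * exp (- \<kappa> * t)))"
    proof (intro sum_mono)
      fix A B assume AB: "A \<in> \<B>" "B \<in> \<B>"
      have "\<bar>I A B t\<bar> \<le> prod w B / prod w A * exp (- \<kappa> * t)"
        unfolding I_def using AB \<B>(2) D \<kappa>
        by (intro integral_ssep_semigroup_centered_product_bounds[OF p S w _ _ _ _ _ t]) auto
      then show "\<bar>a A * a B * I A B t\<bar> \<le> \<bar>a A * a B\<bar> * (prod w B / prod w A * exp (- \<kappa> * t))"
        unfolding abs_mult[of "a A * a B"] by (intro mult_left_mono) auto
    qed
    also have "\<dots> = K * exp (- \<kappa> * t)"
      by (simp add: K_def sum_distrib_right mult.assoc)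
    finally show ?thesis .
  qed

  obtain g where g: "apply_bcontfun g = F" using local_fun_bcontfun[OF S assms(7)] .
  have "((\<lambda>t. 1 / t * variance (\<lambda>\<omega>. LINT s:{0..t}|lborel. F (\<eta> s \<omega>))) \<longlongrightarrow> (\<integral>u. C \<bar>u\<bar> \<partial>lborel)) at_top"
  proof (rule variance_additive_functional_tendsto[OF _ _ _ cov decay \<kappa>])
    show "(\<lambda>(s, \<omega>). indicator {0..} s * F (\<eta> s \<omega>)) \<in> borel_measurable (lborel \<Otimes>\<^sub>M M)"
    proof (rule right_continuous_jointly_measurable)
      show "(\<lambda>\<omega>. F (\<eta> s \<omega>)) \<in> borel_measurable M" if "s \<ge> 0" for s
        by (rule measurable_compose[OF \<eta>_meas[OF that] measurable_local_fun[OF assms(7)]])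
      fix s \<omega> assume "(0::real) \<le> s" "\<omega> \<in> space M"
      then have "((\<lambda>u. \<eta> u \<omega>) \<longlongrightarrow> \<eta> s \<omega>) (at_right s)"
        using \<eta> by (auto simp: markov_process_def cadlag_def)
      then show "((\<lambda>u. F (\<eta> u \<omega>)) \<longlongrightarrow> F (\<eta> s \<omega>)) (at_right s)"
        unfolding g[symmetric] by (rule continuous_on_tendsto_compose[OF continuous_on_apply_bcontfun[of UNIV]]) auto
    qed
    show "\<bar>F (\<eta> s \<omega>)\<bar> \<le> norm g" for s \<omega> using norm_bounded[of g] by (simp add: g)
    show "expectation (\<lambda>\<omega>. F (\<eta> s \<omega>)) = 0" if "s \<ge> 0" for s
      unfolding F_eq using cp_int[OF that] cp_mean \<B>(2) that by simp
  qed
  then have lim: "((\<lambda>t. 1 / t * variance (additive_functional \<eta> F t)) \<longlongrightarrow> (\<integral>u. C \<bar>u\<bar> \<partial>lborel)) at_top"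
    by (simp add: additive_functional_def[abs_def])
  have "0 \<le> (\<integral>u. C \<bar>u\<bar> \<partial>lborel)"
    by (rule tendsto_lowerbound[OF lim])
      (use eventually_ge_at_top[of 0] in \<open>eventually_elim, simp\<close>, simp)
  then show ?thesis using lim by (intro exI[of _ "sqrt (\<integral>u. C \<bar>u\<bar> \<partial>lborel)"]) simp
qed

end
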